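(* Let $k\ge 1$. Consider the multi-object dynamic and observation model described in the context (the standard multi-object system model), and suppose the multi-object posterior at time $k-1$ is a multi-scan GLMB density on $\mathcal F(\mathbb X\times\mathbb L_0)\times\cdots\times\mathcal F(\mathbb X\times\mathbb L_{k-1})$ of the form $$\boldsymbol\pi_{0:k-1}(\mathbf X_{0:k-1})=\Delta(\mathbf X_{0:k-1})\sum_{\xi\in\Xi}w_{0:k-1}^{(\xi)}(\mathcal L(\mathbf X_{0:k-1}))\,\big[p_{0:k-1}^{(\xi)}\big]^{\mathbf X_{0:k-1}} .$$ Then the multi-object posterior at time $k$, i.e. the density $\boldsymbol\pi_{0:k}(\mathbf X_{0:k})\propto g_k(Z_k|\mathbf X_k)\,\mathbf f_{k|k-1}(\mathbf X_k|\mathbf X_{k-1})\,\boldsymbol\pi_{0:k-1}(\mathbf X_{0:k-1})$, is the multi-scan GLMB density $$\boldsymbol\pi_{0:k}(\mathbf X_{0:k})\propto\Delta(\mathbf X_{0:k})\sum_{\xi\in\Xi}\ \sum_{\theta_k\in\Theta_k}w_{0:k}^{(\xi,\theta_k)}(\mathcal L(\mathbf X_{0:k-1}))\,\delta_{\mathcal D(\theta_k)}[\mathcal L(\mathbf X_k)]\,\big[p_{0:k}^{(\xi,\theta_k)}\big]^{\mathbf X_{0:k}},$$ where $$w_{0:k}^{(\xi,\theta_k)}(I_{0:k-1})=1_{\mathcal F(\mathbb B_k\uplus I_{k-1})}(\mathcal D(\theta_k))\,\big[w_{k|k-1}^{(\xi,\theta_k)}\big]^{\mathbb B_k\uplus I_{k-1}}\,w_{0:k-1}^{(\xi)}(I_{0:k-1}),$$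 $$w_{k|k-1}^{(\xi,\theta_k)}(\ell)=\begin{cases}\bar\Lambda_{B,k}^{(\theta_k(\ell))}(\ell),&\ell\in\mathcal D(\theta_k)\cap\mathbb B_k,\\ \bar\Lambda_{S,k|k-1}^{(\xi,\theta_k(\ell))}(\ell),&\ell\in\mathcal D(\theta_k)-\mathbb B_k,\\ Q_{B,k}(\ell),&\ell\in\mathbb B_k-\mathcal D(\theta_k),\\ \bar Q_{S,k-1}^{(\xi)}(\ell),&\text{otherwise},\end{cases}$$ $$p_{0:k}^{(\xi,\theta_k)}(x_{s(\ell):t(\ell)}^{(\ell)};\ell)=\begin{cases}\dfrac{\Lambda_{B,k}^{(\theta_k(\ell))}(x_k^{(\ell)},\ell)}{\bar\Lambda_{B,k}^{(\theta_k(\ell))}(\ell)},&s(\ell)=k,\\[2mm] \dfrac{\Lambda_{S,k|k-1}^{(\theta_k(\ell))}(x_k^{(\ell)}|x_{k-1}^{(\ell)},\ell)\,p_{0:k-1}^{(\xi)}(x_{s(\ell):k-1}^{(\ell)};\ell)}{\bar\Lambda_{S,k|k-1}^{(\xi,\theta_k(\ell))}(\ell)},&t(\ell)=k>s(\ell),\\[2mm] \dfrac{Q_{S,k-1}(x_{k-1}^{(\ell)},\ell)\,p_{0:k-1}^{(\xi)}(x_{s(\ell):k-1}^{(\ell)};\ell)}{\bar Q_{S,k-1}^{(\xi)}(\ell)},&t(\ell)=k-1,\\[2mm] p_{0:k-1}^{(\xi)}(x_{s(\ell):t(\ell)}^{(\ell)};\ell),&t(\ell)<k-1.\end{cases}$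$
   Context: Labels and states. $\mathbb X$ is the single-object state space (with reference measure $dx$, e.g. $\mathbb R^d$ with Lebesgue measure). $\mathbb B_s$ is the finite set of labels $\ell=(s,\alpha)$ of objects born at time $s$; $\mathbb L_k=\biguplus_{s=0}^k\mathbb B_s$. $\mathcal F(S)$ is the class of finite subsets of $S$; $1_S$ is the indicator function of $S$; $\delta_Y[X]=1$ if $X=Y$, else $0$; $\uplus$ is disjoint union; $\{j:k\}=\{j,\dots,k\}$; $X_{m:n}$ abbreviates $X_m,\dots,X_n$; $\langle f,g\rangle=\int f(x)g(x)dx$. For a function $f$ and finite set $X$, $f^X=[f]^X=\prod_{x\in X}f(x)$, with $f^\emptyset=1$. A labeled multi-object state at time $i$ is a finite set $\mathbf X_i\subset\mathbb X\times\mathbb L_i$ with distinct labels; $\mathcal L((x,\ell))=\ell$, $\mathcal L(\mathbf X)$ is the set of labels of $\mathbf X$, and $\Delta(\mathbf X)=\delta_{|\mathbf X|}[|\mathcal L(\mathbf X)|]$. For sequences, $\Delta(\mathbf X_{j:k})=\prod_{i=j}^k\Delta(\mathbf X_i)$, $\mathcal L(\mathbf X_{j:k})=[\mathcal L(\mathbf X_j),\dots,\mathcal L(\mathbf X_k)]$. Trajectories. For $\mathbf X_{j:k}$ let $\mathbf x_i^{(\ell)}=(x_i^{(\ell)},\ell)$ be the element of $\mathbf X_i$ with label $\ell$. For $\ell=(b,\alpha)\in\bigcup_{i=j}^k\mathcal L(\mathbf X_i)$, $s(\ell)=\max\{j,b\}$ and $t(\ell)=s(\ell)+\sum_{i=s(\ell)+1}^k1_{\mathcal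 L(\mathbf X_i)}(\ell)$. Sequences are understood to represent sets of trajectories: each such $\ell$ is present exactly at times $s(\ell),\dots,t(\ell)$ (label sequences violating this carry weight $0$, and the corresponding terms are $0$). The trajectory of $\ell$ is $\mathbf x_{s(\ell):t(\ell)}^{(\ell)}=[(x_{s(\ell)}^{(\ell)},\ell),\dots,(x_{t(\ell)}^{(\ell)},\ell)]$. For a function $h$ of trajectories, written $h(\mathbf x_{s(\ell):t(\ell)}^{(\ell)})=h(x_{s(\ell):t(\ell)}^{(\ell)};\ell)$, the multi-scan exponential is $[h]^{\mathbf X_{j:k}}=\prod_{\ell\in\bigcup_{i=j}^k\mathcal L(\mathbf X_i)}h(\mathbf x_{s(\ell):t(\ell)}^{(\ell)})$. Multi-scan GLMB. A multi-scan GLMB density on $\mathcal F(\mathbb X\times\mathbb L_j)\times\cdots\times\mathcal F(\mathbb X\times\mathbb L_k)$ is $\boldsymbol\pi(\mathbf X_{j:k})=\Delta(\mathbf X_{j:k})\sum_{\xi\in\Xi}w^{(\xi)}(\mathcal L(\mathbf X_{j:k}))[p^{(\xi)}]^{\mathbf X_{j:k}}$, with $\Xi$ a discrete index set, $w^{(\xi)}(I_{j:k})\ge0$ for $I_{j:k}\in\mathcal F(\mathbb L_j)\times\cdots\times\mathcal F(\mathbb L_k)$, $\sum_\xi\sum_{I_{j:k}}w^{(\xi)}(I_{j:k})=1$, and each $p^{(\xi)}(\cdot;\ell)$ a probability density on $\mathbb X^{t(\ell)-s(\ell)+1}$ (for each possible trajectory length). In the posterior at time $k$, the index set is $\Xi\times\Theta_k$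 and "$\propto$" means equality up to a normalising constant not depending on $\mathbf X_{0:k}$. The Bayes recursion is assumed well defined (normalising constant positive and finite). Dynamic model. Given $\mathbf X_{k-1}$, independently each $(x_{k-1},\ell)\in\mathbf X_{k-1}$ survives with probability $P_{S,k-1}(x_{k-1},\ell)$ and moves to $(x_k,\ell)$ with density $f_{S,k|k-1}(x_k|x_{k-1},\ell)$, or dies with probability $Q_{S,k-1}=1-P_{S,k-1}$; independently for each $\ell\in\mathbb B_k$ an object $(x_k,\ell)$ is born with probability $P_{B,k}(\ell)$ and density $f_{B,k}(x_k,\ell)$, or not with probability $Q_{B,k}(\ell)=1-P_{B,k}(\ell)$. $\mathbf X_k$ is the union of survivors and births. Its multi-object transition density is $\mathbf f_{k|k-1}(\mathbf X_k|\mathbf X_{k-1})=\Delta(\mathbf X_k)1_{\mathcal F(\mathbb B_k\uplus\mathcal L(\mathbf X_{k-1}))}(\mathcal L(\mathbf X_k))\,Q_{B,k}^{\mathbb B_k-\mathcal L(\mathbf X_k)}\prod_{\ell\in\mathcal L(\mathbf X_{k-1})-\mathcal L(\mathbf X_k)}Q_{S,k-1}(x_{k-1}^{(\ell)},\ell)\prod_{\ell\in\mathbb B_k\cap\mathcal L(\mathbf X_k)}P_{B,k}(\ell)f_{B,k}(x_k^{(\ell)},\ell)\prod_{\ell\in\mathcal L(\mathbf X_{k-1})\cap\mathcal L(\mathbf X_k)}P_{S,k-1}(x_{k-1}^{(\ell)},\ell)f_{S,k|k-1}(x_k^{(\ell)}|x_{k-1}^{(\ell)},\ell)$. Observation model.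 $Z_k=\{z_1,\dots,z_m\}$ is the finite measurement set at time $k$. $\Theta_k$ is the set of positive 1-1 maps $\theta_k:\mathcal D(\theta_k)\to\{0,\dots,|Z_k|\}$ with domain $\mathcal D(\theta_k)\subseteq\mathbb L_k$, where positive 1-1 means that distinct arguments are never assigned the same positive value; $\Theta_k(I)$ is the subset with domain $I$. The multi-object likelihood is $g_k(Z_k|\mathbf X_k)\propto\sum_{\theta_k\in\Theta_k}1_{\Theta_k(\mathcal L(\mathbf X_k))}(\theta_k)\prod_{(x,\ell)\in\mathbf X_k}\psi_{k,Z_k}^{(\theta_k(\ell))}(x,\ell)$ (up to a factor depending only on $Z_k$), where $\psi_{k,Z_k}^{(j)}(x,\ell)=P_{D,k}(x,\ell)g_{D,k}(z_j|x,\ell)/\kappa_k(z_j)$ if $j>0$ and $\psi_{k,Z_k}^{(0)}(x,\ell)=1-P_{D,k}(x,\ell)$; $P_{D,k}$ is the detection probability, $g_{D,k}$ the single-object likelihood, $\kappa_k>0$ the Poisson clutter intensity. Quantities in the claim. $\Lambda_{B,k}^{(j)}(x,\ell)=\psi_{k,Z_k}^{(j)}(x,\ell)f_{B,k}(x,\ell)P_{B,k}(\ell)$; $\Lambda_{S,k|k-1}^{(j)}(x|\varsigma,\ell)=\psi_{k,Z_k}^{(j)}(x,\ell)f_{S,k|k-1}(x|\varsigma,\ell)P_{S,k-1}(\varsigma,\ell)$; $p_{k-1}^{(\xi)}(\cdot,\ell)$ is the marginal in $x_{k-1}$ of $p_{0:k-1}^{(\xi)}(x_{s(\ell):k-1};\ell)$;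 $\bar Q_{S,k-1}^{(\xi)}(\ell)=\langle Q_{S,k-1}(\cdot,\ell),p_{k-1}^{(\xi)}(\cdot,\ell)\rangle$; $\bar\Lambda_{B,k}^{(j)}(\ell)=\int\Lambda_{B,k}^{(j)}(x,\ell)dx$; $\bar\Lambda_{S,k|k-1}^{(\xi,j)}(\ell)=\int\langle\Lambda_{S,k|k-1}^{(j)}(x|\cdot,\ell),p_{k-1}^{(\xi)}(\cdot,\ell)\rangle dx$. When a denominator in $p_{0:k}^{(\xi,\theta_k)}$ vanishes, the corresponding component has weight $0$ and the density there may be chosen arbitrarily. *)

theory Defs
  imports "HOL-Analysis.Analysis"
begin

text \<open>
  All weights, probabilities and densities take values in \<^typ>\<open>ennreal\<close>, so that sums over an
  arbitrary index set and integrals of nonnegative functions always exist. Sequences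
  indexed by \<^term>\<open>{j..k}\<close> are extensional functions on that interval.
\<close>

subsection \<open>Labels, multi-object states and trajectories\<close>

text \<open>A label is a pair (time of birth, index).\<close>

type_synonym 'a label = "nat \<times> 'a"
type_synonym ('x, 'a) mstate = "('x \<times> 'a label) set"

text \<open>
  \<open>fS \<MM> k x \<zeta> l\<close> is the density at \<open>x\<close> of the move from \<open>\<zeta>\<close> (time \<open>k - 1\<close>) to time \<open>k\<close>,
  \<open>PS \<MM> i\<close> is the probability of surviving from time \<open>i\<close> to \<open>i + 1\<close>, and \<open>gD \<MM> k z x l\<close> is
  the single-object likelihood of the measurement \<open>z\<close>.
\<close>

record ('x, 'a, 'z) mo_system =
  refM :: "'x measure"
  births :: "nat \<Rightarrow> 'a label set"
  PS :: "nat \<Rightarrow> 'x \<Rightarrow> 'a label \<Rightarrow> ennreal"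
  fS :: "nat \<Rightarrow> 'x \<Rightarrow> 'x \<Rightarrow> 'a label \<Rightarrow> ennreal"
  PB :: "nat \<Rightarrow> 'a label \<Rightarrow> ennreal"
  fB :: "nat \<Rightarrow> 'x \<Rightarrow> 'a label \<Rightarrow> ennreal"
  PD :: "nat \<Rightarrow> 'x \<Rightarrow> 'a label \<Rightarrow> ennreal"
  gD :: "nat \<Rightarrow> 'z \<Rightarrow> 'x \<Rightarrow> 'a label \<Rightarrow> ennreal"
  clutter :: "nat \<Rightarrow> 'z \<Rightarrow> ennreal"

definition label_space :: "('x, 'a, 'z) mo_system \<Rightarrow> nat \<Rightarrow> 'a label set" where
  "label_space \<MM> k = (\<Union>s\<in>{0..k}. births \<MM> s)"

definition mo_system_model :: "('x, 'a, 'z) mo_system \<Rightarrow> bool" where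
  "mo_system_model \<MM> \<longleftrightarrow>
     sigma_finite_measure (refM \<MM>) \<and>
     (\<forall>s. finite (births \<MM> s) \<and> (\<forall>l\<in>births \<MM> s. fst l = s)) \<and>
     (\<forall>k. \<forall>l\<in>label_space \<MM> k.
        (\<lambda>x. PS \<MM> k x l) \<in> borel_measurable (refM \<MM>) \<and>
        (\<forall>x\<in>space (refM \<MM>). PS \<MM> k x l \<le> 1) \<and>
        (\<lambda>(x, \<zeta>). fS \<MM> (Suc k) x \<zeta> l) \<in> borel_measurable (refM \<MM> \<Otimes>\<^sub>M refM \<MM>) \<and>
        (\<forall>\<zeta>\<in>space (refM \<MM>). (\<integral>\<^sup>+x. fS \<MM> (Suc k) x \<zeta> l \<partial>refM \<MM>) = 1) \<and>
        (\<lambda>x. PD \<MM> k x l) \<in> borel_measurable (refM \<MM>) \<and>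
        (\<forall>x\<in>space (refM \<MM>). PD \<MM> k x l \<le> 1) \<and>
        (\<forall>z. (\<lambda>x. gD \<MM> k z x l) \<in> borel_measurable (refM \<MM>))) \<and>
     (\<forall>k. \<forall>l\<in>births \<MM> k.
        PB \<MM> k l \<le> 1 \<and>
        (\<lambda>x. fB \<MM> k x l) \<in> borel_measurable (refM \<MM>) \<and>
        (\<integral>\<^sup>+x. fB \<MM> k x l \<partial>refM \<MM>) = 1) \<and>
     (\<forall>k z. 0 < clutter \<MM> k z \<and> clutter \<MM> k z < \<infinity>)"

definition QS :: "('x, 'a, 'z) mo_system \<Rightarrow> nat \<Rightarrow> 'x \<Rightarrow> 'a label \<Rightarrow> ennreal" where
  "QS \<MM> k x l = 1 - PS \<MM> k x l"

definition QB :: "('x, 'a, 'z) mo_system \<Rightarrow> nat \<Rightarrow> 'a label \<Rightarrow> ennreal" where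
  "QB \<MM> k l = 1 - PB \<MM> k l"

definition labels :: "('x, 'a) mstate \<Rightarrow> 'a label set" where
  "labels Y = snd ` Y"

definition distinct_ind :: "('x, 'a) mstate \<Rightarrow> ennreal" where
  "distinct_ind Y = of_bool (card Y = card (labels Y))"

text \<open>The unlabeled state of the object with label \<open>l\<close>; meaningful if labels are distinct.\<close>

definition state_of :: "('x, 'a) mstate \<Rightarrow> 'a label \<Rightarrow> 'x" where
  "state_of Y l = (THE x. (x, l) \<in> Y)"

definition mstates :: "('x, 'a, 'z) mo_system \<Rightarrow> nat \<Rightarrow> ('x, 'a) mstate set" where
  "mstates \<MM> i = Fpow (space (refM \<MM>) \<times> label_space \<MM> i)"

definition mstate_seqs ::
    "('x, 'a, 'z) mo_system \<Rightarrow> nat \<Rightarrow> nat \<Rightarrow> (nat \<Rightarrow> ('x, 'a) mstate) set" where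
  "mstate_seqs \<MM> j k = (\<Pi>\<^sub>E i\<in>{j..k}. mstates \<MM> i)"

definition label_seqs :: "('x, 'a, 'z) mo_system \<Rightarrow> nat \<Rightarrow> nat \<Rightarrow> (nat \<Rightarrow> 'a label set) set" where
  "label_seqs \<MM> j k = (\<Pi>\<^sub>E i\<in>{j..k}. Fpow (label_space \<MM> i))"

definition labels_seq ::
    "nat \<Rightarrow> nat \<Rightarrow> (nat \<Rightarrow> ('x, 'a) mstate) \<Rightarrow> nat \<Rightarrow> 'a label set" where
  "labels_seq j k X = (\<lambda>i\<in>{j..k}. labels (X i))"

definition distinct_ind_seq :: "nat \<Rightarrow> nat \<Rightarrow> (nat \<Rightarrow> ('x, 'a) mstate) \<Rightarrow> ennreal" where
  "distinct_ind_seq j k X = (\<Prod>i\<in>{j..k}. distinct_ind (X i))"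

definition start_time :: "nat \<Rightarrow> 'a label \<Rightarrow> nat" where
  "start_time j l = max j (fst l)"

definition end_time :: "nat \<Rightarrow> nat \<Rightarrow> (nat \<Rightarrow> 'a label set) \<Rightarrow> 'a label \<Rightarrow> nat" where
  "end_time j k I l = start_time j l + (\<Sum>i\<in>{start_time j l + 1..k}. indicator (I i) l)"

text \<open>The label sequences that come from sets of trajectories: no gaps, no late starts.\<close>

definition trajectory_labels :: "nat \<Rightarrow> nat \<Rightarrow> (nat \<Rightarrow> 'a label set) \<Rightarrow> bool" where
  "trajectory_labels j k I \<longleftrightarrow>
     (\<forall>l\<in>(\<Union>i\<in>{j..k}. I i). \<forall>i\<in>{j..k}.
        l \<in> I i \<longleftrightarrow> start_time j l \<le> i \<and> i \<le> end_time j k I l)"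

text \<open>
  A function \<open>h\<close> of trajectories is applied as \<open>h t x l\<close>, where \<open>t\<close> is the last time of the
  trajectory and \<open>x\<close> is extensional on \<open>{s..t}\<close>; the first time \<open>s\<close> is determined by \<open>l\<close>.
\<close>

type_synonym ('x, 'a) traj_fun = "nat \<Rightarrow> (nat \<Rightarrow> 'x) \<Rightarrow> 'a label \<Rightarrow> ennreal"

definition multiscan_exp ::
    "nat \<Rightarrow> nat \<Rightarrow> ('x, 'a) traj_fun \<Rightarrow> (nat \<Rightarrow> ('x, 'a) mstate) \<Rightarrow> ennreal" where
  "multiscan_exp j k h X =
     (\<Prod>l\<in>(\<Union>i\<in>{j..k}. labels (X i)).
        let s = start_time j l; t = end_time j k (labels_seq j k X) l
        in h t (\<lambda>i\<in>{s..t}. state_of (X i) l) l)"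

subsection \<open>Multi-scan GLMB densities\<close>

definition traj_densities ::
    "('x, 'a, 'z) mo_system \<Rightarrow> nat \<Rightarrow> nat \<Rightarrow> ('x, 'a) traj_fun \<Rightarrow> bool" where
  "traj_densities \<MM> j k h \<longleftrightarrow>
     (\<forall>l\<in>label_space \<MM> k. \<forall>t\<in>{start_time j l..k}.
        (\<lambda>x. h t x l) \<in> borel_measurable (\<Pi>\<^sub>M i\<in>{start_time j l..t}. refM \<MM>) \<and>
        (\<integral>\<^sup>+x. h t x l \<partial>(\<Pi>\<^sub>M i\<in>{start_time j l..t}. refM \<MM>)) = 1)"

definition multiscan_glmb_params ::
    "('x, 'a, 'z) mo_system \<Rightarrow> nat \<Rightarrow> nat \<Rightarrow> 'c set \<Rightarrow> ('c \<Rightarrow> (nat \<Rightarrow> 'a label set) \<Rightarrow> ennreal) \<Rightarrow>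
     ('c \<Rightarrow> ('x, 'a) traj_fun) \<Rightarrow> bool" where
  "multiscan_glmb_params \<MM> j k \<Xi> w p \<longleftrightarrow>
     (\<Sum>\<^sub>\<infinity>\<xi>\<in>\<Xi>. \<Sum>I\<in>label_seqs \<MM> j k. w \<xi> I) = 1 \<and>
     (\<forall>\<xi>\<in>\<Xi>. \<forall>I\<in>label_seqs \<MM> j k. \<not> trajectory_labels j k I \<longrightarrow> w \<xi> I = 0) \<and>
     (\<forall>\<xi>\<in>\<Xi>. traj_densities \<MM> j k (p \<xi>))"

definition multiscan_glmb ::
    "nat \<Rightarrow> nat \<Rightarrow> 'c set \<Rightarrow> ('c \<Rightarrow> (nat \<Rightarrow> 'a label set) \<Rightarrow> ennreal) \<Rightarrow> ('c \<Rightarrow> ('x, 'a) traj_fun) \<Rightarrow>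
     (nat \<Rightarrow> ('x, 'a) mstate) \<Rightarrow> ennreal" where
  "multiscan_glmb j k \<Xi> w p X =
     distinct_ind_seq j k X *
     (\<Sum>\<^sub>\<infinity>\<xi>\<in>\<Xi>. w \<xi> (labels_seq j k X) * multiscan_exp j k (p \<xi>) X)"

subsection \<open>Integration over sequences of labeled multi-object states\<close>

text \<open>
  A sequence of states with distinct labels is determined by its label sequence \<open>I\<close> and by
  one point of the state space for every pair \<open>(i, l)\<close> with \<open>l \<in> I i\<close>. The reference measure
  is thus the sum over all \<open>I\<close> of product measures, which is the (iterated) set integral for
  functions vanishing on states with repeated labels: the \<open>n!\<close> orderings of a state with \<open>n\<close>
  objects cancel the factor \<open>1/n!\<close>.
\<close>

definition states_of_labels ::
    "nat \<Rightarrow> nat \<Rightarrow> (nat \<Rightarrow> 'a label set) \<Rightarrow> (nat \<times> 'a label \<Rightarrow> 'x) \<Rightarrow> nat \<Rightarrow> ('x, 'a) mstate" where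
  "states_of_labels j k I x = (\<lambda>i\<in>{j..k}. (\<lambda>l. (x (i, l), l)) ` I i)"

definition multiscan_integral ::
    "('x, 'a, 'z) mo_system \<Rightarrow> nat \<Rightarrow> nat \<Rightarrow> ((nat \<Rightarrow> ('x, 'a) mstate) \<Rightarrow> ennreal) \<Rightarrow> ennreal" where
  "multiscan_integral \<MM> j k F =
     (\<Sum>I\<in>label_seqs \<MM> j k.
        \<integral>\<^sup>+x. F (states_of_labels j k I x) \<partial>(\<Pi>\<^sub>M il\<in>Sigma {j..k} I. refM \<MM>))"

text \<open>Almost everywhere; sequences with a repeated label are never exceptional.\<close>

definition multiscan_AE ::
    "('x, 'a, 'z) mo_system \<Rightarrow> nat \<Rightarrow> nat \<Rightarrow> ((nat \<Rightarrow> ('x, 'a) mstate) \<Rightarrow> bool) \<Rightarrow> bool" where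
  "multiscan_AE \<MM> j k P \<longleftrightarrow>
     (\<forall>X\<in>mstate_seqs \<MM> j k. distinct_ind_seq j k X = 0 \<longrightarrow> P X) \<and>
     (\<forall>I\<in>label_seqs \<MM> j k.
        AE x in (\<Pi>\<^sub>M il\<in>Sigma {j..k} I. refM \<MM>). P (states_of_labels j k I x))"

subsection \<open>Dynamic model, observation model and Bayes recursion\<close>

definition transition_density ::
    "('x, 'a, 'z) mo_system \<Rightarrow> nat \<Rightarrow> ('x, 'a) mstate \<Rightarrow> ('x, 'a) mstate \<Rightarrow> ennreal" where
  "transition_density \<MM> k Y Y' =
     distinct_ind Y *
     indicator (Fpow (births \<MM> k \<union> labels Y')) (labels Y) *
     (\<Prod>l\<in>births \<MM> k - labels Y. QB \<MM> k l) *
     (\<Prod>l\<in>labels Y' - labels Y. QS \<MM> (k - 1) (state_of Y' l) l) *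
     (\<Prod>l\<in>births \<MM> k \<inter> labels Y. PB \<MM> k l * fB \<MM> k (state_of Y l) l) *
     (\<Prod>l\<in>labels Y' \<inter> labels Y.
        PS \<MM> (k - 1) (state_of Y' l) l * fS \<MM> k (state_of Y l) (state_of Y' l) l)"

text \<open>
  Association maps are partial functions, with \<^term>\<open>dom \<theta>\<close> the domain of the map. The
  measurements are enumerated as \<open>z 1, \<dots>, z m\<close>.
\<close>

definition assoc_maps ::
    "('x, 'a, 'z) mo_system \<Rightarrow> nat \<Rightarrow> 'z set \<Rightarrow> ('a label \<Rightarrow> nat option) set" where
  "assoc_maps \<MM> k Z =
     {\<theta>. dom \<theta> \<subseteq> label_space \<MM> k \<and> ran \<theta> \<subseteq> {0..card Z} \<and>
         (\<forall>l\<in>dom \<theta>. \<forall>l'\<in>dom \<theta>. the (\<theta> l) = the (\<theta> l') \<and> the (\<theta> l) > 0 \<longrightarrow> l = l')}"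

definition assoc_maps_on ::
    "('x, 'a, 'z) mo_system \<Rightarrow> nat \<Rightarrow> 'z set \<Rightarrow> 'a label set \<Rightarrow> ('a label \<Rightarrow> nat option) set" where
  "assoc_maps_on \<MM> k Z J = {\<theta>\<in>assoc_maps \<MM> k Z. dom \<theta> = J}"

definition psi ::
    "('x, 'a, 'z) mo_system \<Rightarrow> nat \<Rightarrow> (nat \<Rightarrow> 'z) \<Rightarrow> nat \<Rightarrow> 'x \<Rightarrow> 'a label \<Rightarrow> ennreal" where
  "psi \<MM> k z j x l =
     (if j > 0 then PD \<MM> k x l * gD \<MM> k (z j) x l / clutter \<MM> k (z j) else 1 - PD \<MM> k x l)"

definition likelihood_sum ::
    "('x, 'a, 'z) mo_system \<Rightarrow> nat \<Rightarrow> 'z set \<Rightarrow> (nat \<Rightarrow> 'z) \<Rightarrow> ('x, 'a) mstate \<Rightarrow> ennreal" where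
  "likelihood_sum \<MM> k Z z Y =
     (\<Sum>\<theta>\<in>assoc_maps \<MM> k Z.
        indicator (assoc_maps_on \<MM> k Z (labels Y)) \<theta> *
        (\<Prod>(x, l)\<in>Y. psi \<MM> k z (the (\<theta> l)) x l))"

text \<open>
  Here \<open>g\<close> is the likelihood of the given measurement set as a function of the multi-object
  state, and \<open>\<pi>\<close> is the posterior at time \<open>k - 1\<close>.
\<close>

definition unnorm_posterior ::
    "('x, 'a, 'z) mo_system \<Rightarrow> nat \<Rightarrow> (('x, 'a) mstate \<Rightarrow> ennreal) \<Rightarrow>
     ((nat \<Rightarrow> ('x, 'a) mstate) \<Rightarrow> ennreal) \<Rightarrow> (nat \<Rightarrow> ('x, 'a) mstate) \<Rightarrow> ennreal" where
  "unnorm_posterior \<MM> k g \<pi> X =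
     g (X k) * transition_density \<MM> k (X k) (X (k - 1)) * \<pi> (restrict X {0..k - 1})"

definition norm_const ::
    "('x, 'a, 'z) mo_system \<Rightarrow> nat \<Rightarrow> (('x, 'a) mstate \<Rightarrow> ennreal) \<Rightarrow>
     ((nat \<Rightarrow> ('x, 'a) mstate) \<Rightarrow> ennreal) \<Rightarrow> ennreal" where
  "norm_const \<MM> k g \<pi> = multiscan_integral \<MM> 0 k (unnorm_posterior \<MM> k g \<pi>)"

definition posterior ::
    "('x, 'a, 'z) mo_system \<Rightarrow> nat \<Rightarrow> (('x, 'a) mstate \<Rightarrow> ennreal) \<Rightarrow>
     ((nat \<Rightarrow> ('x, 'a) mstate) \<Rightarrow> ennreal) \<Rightarrow> (nat \<Rightarrow> ('x, 'a) mstate) \<Rightarrow> ennreal" where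
  "posterior \<MM> k g \<pi> X = unnorm_posterior \<MM> k g \<pi> X / norm_const \<MM> k g \<pi>"

subsection \<open>Update of the GLMB parameters\<close>

text \<open>
  Below, \<open>z\<close> enumerates the measurements, \<open>j\<close> is the measurement index assigned to the
  label, and \<open>h\<close> is the trajectory density of one component at time \<open>k - 1\<close>.
\<close>

definition Lambda_B ::
    "('x, 'a, 'z) mo_system \<Rightarrow> nat \<Rightarrow> (nat \<Rightarrow> 'z) \<Rightarrow> nat \<Rightarrow> 'x \<Rightarrow> 'a label \<Rightarrow> ennreal" where
  "Lambda_B \<MM> k z j x l = psi \<MM> k z j x l * fB \<MM> k x l * PB \<MM> k l"

definition Lambda_S ::
    "('x, 'a, 'z) mo_system \<Rightarrow> nat \<Rightarrow> (nat \<Rightarrow> 'z) \<Rightarrow> nat \<Rightarrow> 'x \<Rightarrow> 'x \<Rightarrow> 'a label \<Rightarrow> ennreal" where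
  "Lambda_S \<MM> k z j x \<zeta> l = psi \<MM> k z j x l * fS \<MM> k x \<zeta> l * PS \<MM> (k - 1) \<zeta> l"

definition marginal_last ::
    "('x, 'a, 'z) mo_system \<Rightarrow> nat \<Rightarrow> ('x, 'a) traj_fun \<Rightarrow> 'x \<Rightarrow> 'a label \<Rightarrow> ennreal" where
  "marginal_last \<MM> t h y l =
     (\<integral>\<^sup>+x. h t (x(t := y)) l \<partial>(\<Pi>\<^sub>M i\<in>{start_time 0 l..<t}. refM \<MM>))"

definition QS_bar ::
    "('x, 'a, 'z) mo_system \<Rightarrow> nat \<Rightarrow> ('x, 'a) traj_fun \<Rightarrow> 'a label \<Rightarrow> ennreal" where
  "QS_bar \<MM> k h l =
     (\<integral>\<^sup>+\<zeta>. QS \<MM> (k - 1) \<zeta> l * marginal_last \<MM> (k - 1) h \<zeta> l \<partial>refM \<MM>)"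

definition Lambda_B_bar ::
    "('x, 'a, 'z) mo_system \<Rightarrow> nat \<Rightarrow> (nat \<Rightarrow> 'z) \<Rightarrow> nat \<Rightarrow> 'a label \<Rightarrow> ennreal" where
  "Lambda_B_bar \<MM> k z j l = (\<integral>\<^sup>+x. Lambda_B \<MM> k z j x l \<partial>refM \<MM>)"

definition Lambda_S_bar ::
    "('x, 'a, 'z) mo_system \<Rightarrow> nat \<Rightarrow> (nat \<Rightarrow> 'z) \<Rightarrow> ('x, 'a) traj_fun \<Rightarrow> nat \<Rightarrow> 'a label \<Rightarrow> ennreal" where
  "Lambda_S_bar \<MM> k z h j l =
     (\<integral>\<^sup>+x. (\<integral>\<^sup>+\<zeta>. Lambda_S \<MM> k z j x \<zeta> l * marginal_last \<MM> (k - 1) h \<zeta> l \<partial>refM \<MM>) \<partial>refM \<MM>)"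

definition step_weight ::
    "('x, 'a, 'z) mo_system \<Rightarrow> nat \<Rightarrow> (nat \<Rightarrow> 'z) \<Rightarrow> ('x, 'a) traj_fun \<Rightarrow> ('a label \<Rightarrow> nat option) \<Rightarrow>
     'a label \<Rightarrow> ennreal" where
  "step_weight \<MM> k z h \<theta> l =
     (if l \<in> dom \<theta> \<inter> births \<MM> k then Lambda_B_bar \<MM> k z (the (\<theta> l)) l
      else if l \<in> dom \<theta> - births \<MM> k then Lambda_S_bar \<MM> k z h (the (\<theta> l)) l
      else if l \<in> births \<MM> k - dom \<theta> then QB \<MM> k l
      else QS_bar \<MM> k h l)"

definition update_weight ::
    "('x, 'a, 'z) mo_system \<Rightarrow> nat \<Rightarrow> (nat \<Rightarrow> 'z) \<Rightarrow> ('c \<Rightarrow> (nat \<Rightarrow> 'a label set) \<Rightarrow> ennreal) \<Rightarrow>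
     ('c \<Rightarrow> ('x, 'a) traj_fun) \<Rightarrow> 'c \<times> ('a label \<Rightarrow> nat option) \<Rightarrow> (nat \<Rightarrow> 'a label set) \<Rightarrow> ennreal" where
  "update_weight \<MM> k z w p = (\<lambda>(\<xi>, \<theta>) I.
     indicator (Fpow (births \<MM> k \<union> I (k - 1))) (dom \<theta>) *
     (\<Prod>l\<in>births \<MM> k \<union> I (k - 1). step_weight \<MM> k z (p \<xi>) \<theta> l) *
     w \<xi> I)"

text \<open>
  The component with numerator \<open>a\<close> and denominator \<open>d\<close>. If \<open>d = 0\<close>, the component has weight
  0 and its density is an arbitrary \<open>r\<close>; likewise if \<open>d = \<infinity>\<close>, where finiteness of the
  normalising constant forces the weight to be 0.
\<close>

definition normalised :: "ennreal \<Rightarrow> ennreal \<Rightarrow> ennreal \<Rightarrow> ennreal" where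
  "normalised r a d = (if d = 0 \<or> d = \<infinity> then r else a / d)"

text \<open>
  For a trajectory ending at time \<open>k\<close> whose label is not in the domain of \<open>\<theta>\<close>, the index
  \<^term>\<open>the (\<theta> l)\<close> is unspecified; no component of nonzero weight uses this value.
\<close>

definition update_density ::
    "('x, 'a, 'z) mo_system \<Rightarrow> nat \<Rightarrow> (nat \<Rightarrow> 'z) \<Rightarrow>
     ('c \<times> ('a label \<Rightarrow> nat option) \<Rightarrow> ('x, 'a) traj_fun) \<Rightarrow> ('c \<Rightarrow> ('x, 'a) traj_fun) \<Rightarrow>
     'c \<times> ('a label \<Rightarrow> nat option) \<Rightarrow> ('x, 'a) traj_fun" where
  "update_density \<MM> k z r p = (\<lambda>(\<xi>, \<theta>) t x l.
     let s = start_time 0 l in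
     if s = k then
       normalised (r (\<xi>, \<theta>) t x l)
         (Lambda_B \<MM> k z (the (\<theta> l)) (x k) l)
         (Lambda_B_bar \<MM> k z (the (\<theta> l)) l)
     else if t = k then
       normalised (r (\<xi>, \<theta>) t x l)
         (Lambda_S \<MM> k z (the (\<theta> l)) (x k) (x (k - 1)) l * p \<xi> (k - 1) (restrict x {s..k - 1}) l)
         (Lambda_S_bar \<MM> k z (p \<xi>) (the (\<theta> l)) l)
     else if t = k - 1 then
       normalised (r (\<xi>, \<theta>) t x l)
         (QS \<MM> (k - 1) (x (k - 1)) l * p \<xi> (k - 1) (restrict x {s..k - 1}) l)
         (QS_bar \<MM> k (p \<xi>) l)
     else p \<xi> t x l)"

text \<open>
  None of the denominators that occur in the components contributing at \<open>X\<close> vanishes or is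
  infinite.
\<close>

definition nondegenerate_at ::
    "('x, 'a, 'z) mo_system \<Rightarrow> nat \<Rightarrow> 'z set \<Rightarrow> (nat \<Rightarrow> 'z) \<Rightarrow> 'c set \<Rightarrow>
     ('c \<Rightarrow> ('x, 'a) traj_fun) \<Rightarrow> (nat \<Rightarrow> ('x, 'a) mstate) \<Rightarrow> bool" where
  "nondegenerate_at \<MM> k Z z \<Xi> p X \<longleftrightarrow>
     (\<forall>\<xi>\<in>\<Xi>. \<forall>\<theta>\<in>assoc_maps_on \<MM> k Z (labels (X k)).
        \<forall>l\<in>(births \<MM> k \<inter> labels (X k)) \<union> labels (X (k - 1)).
          0 < step_weight \<MM> k z (p \<xi>) \<theta> l \<and> step_weight \<MM> k z (p \<xi>) \<theta> l < \<infinity>)"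

end

theory Submission
  imports Defs
begin

text \<open>
  Expand the likelihood over the association maps \<open>\<theta>\<close> and the prior over \<open>\<xi>\<close>. On a state
  sequence with distinct labels the term of \<open>(\<xi>, \<theta>)\<close> is a weight times a product over
  trajectories, in which each trajectory born at time \<open>k\<close>, surviving to \<open>k\<close> or dying after \<open>k - 1\<close>
  contributes the numerator of its new density. By Tonelli, applied label by label, the term
  integrates over all states with given labels to the updated weight, since each numerator
  integrates to its denominator. Hence the normalising constant is the sum of the updated
  weights times the likelihood constant. Finiteness of this sum makes each weight finite. A term
  of weight 0 vanishes almost everywhere, a term of positive finite weight has only positive
  finite denominators and can be normalised factor by factor, and the exceptional null sets of
  the terms can be united because only countably many \<open>\<xi>\<close> have nonzero weight.
\<close>

subsection \<open>Sums of extended nonnegative reals over arbitrary index sets\<close>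

text \<open>The main obstacle is division. A denominator such as \<open>Lambda_S_bar\<close> may be
  0, and it may be \<infinity> because \<open>gD\<close> is only assumed measurable; the quotient
  then no longer determines the numerator. All exact work is therefore done with the undivided
  numerators \<open>step_num\<close>: the terms built from them add up, after multiplication by the
  likelihood constant, to the unnormalised posterior at every state sequence with distinct labels,
  and division enters only afterwards. This also explains the restriction to almost every sequence:
  a numerator with integral 0 can be nonzero on a null set, where its component of weight 0
  contributes nothing. Since \<open>0 * \<infinity> = 0\<close> in \<open>ennreal\<close>, Tonelli
  yields a product of integrals even when some are 0 and others infinite, so weight 0 always means
  integral 0. The second obstacle is bookkeeping: the reference measure is indexed by time and
  label, the densities by whole trajectories. Passing between the two needs label sequences without
  gaps; on all others the prior or the transition density vanishes.\<close>

lemma ennreal_mult_divide_cancel_left: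
  fixes a b c :: ennreal
  assumes "0 < c" "c < \<infinity>" "0 < b" "b < \<infinity>"
  shows "(c * a) / (c * b) = a / b"
proof -
  have "c * inverse c = 1"
    using ennreal_divide_self[of c] assms by (simp add: divide_ennreal_def)
  then have "c * a * (inverse c * inverse b) = a * inverse b"
    by (metis mult.assoc mult.commute mult_1)
  then show ?thesis
    using assms by (simp add: divide_ennreal_def ennreal_inverse_mult)
qed

lemma summable_on_ennreal_values [simp]:
  fixes f :: "'a \<Rightarrow> ennreal"
  shows "f summable_on A"
  by (simp add: nonneg_summable_on_complete)

lemma infsum_cmult_right_ennreal:
  fixes f :: "'a \<Rightarrow> ennreal"
  shows "(\<Sum>\<^sub>\<infinity>x\<in>A. c * f x) = c * (\<Sum>\<^sub>\<infinity>x\<in>A. f x)"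
proof -
  have "{F. finite F \<and> F \<subseteq> A} \<noteq> {}" by auto
  then show ?thesis
    by (simp add: nonneg_infsum_complete SUP_mult_left_ennreal sum_distrib_left)
qed

lemma sum_infsum_ennreal:
  fixes f :: "'a \<Rightarrow> 'b \<Rightarrow> ennreal"
  assumes "finite B"
  shows "(\<Sum>b\<in>B. \<Sum>\<^sub>\<infinity>a\<in>A. f a b) = (\<Sum>\<^sub>\<infinity>a\<in>A. \<Sum>b\<in>B. f a b)"
  using assms by induction (simp_all add: infsum_add)

text \<open>Induction on the second factor suffices because it will be the finite set of association
  maps; the set of prior components stays arbitrary.\<close>

lemma infsum_Times_finite_ennreal:
  fixes f :: "'a \<times> 'b \<Rightarrow> ennreal"
  assumes "finite B"
  shows "(\<Sum>\<^sub>\<infinity>c\<in>A \<times> B. f c) = (\<Sum>\<^sub>\<infinity>a\<in>A. \<Sum>b\<in>B. f (a, b))"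
  using assms
proof (induction B)
  case (insert b B)
  have "A \<times> insert b B = A \<times> B \<union> (\<lambda>a. (a, b)) ` A" by auto
  then have "(\<Sum>\<^sub>\<infinity>c\<in>A \<times> insert b B. f c)
      = (\<Sum>\<^sub>\<infinity>c\<in>A \<times> B. f c) + (\<Sum>\<^sub>\<infinity>c\<in>(\<lambda>a. (a, b)) ` A. f c)"
    using insert.hyps by (simp only:) (rule infsum_Un_disjoint, auto)
  also have "(\<Sum>\<^sub>\<infinity>c\<in>(\<lambda>a. (a, b)) ` A. f c) = (\<Sum>\<^sub>\<infinity>a\<in>A. f (a, b))"
    by (subst infsum_reindex) (auto simp: inj_on_def o_def)
  finally show ?case
    using insert by (simp add: infsum_add add.commute)
qed simp

text \<open>Infinitely many terms above a fixed positive bound would make the sum infinite, so each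
  level set is finite, and the support is the union of the level sets for the bounds
  \<open>1 / (n + 1)\<close>.\<close>

lemma countable_support_infsum_ennreal:
  fixes f :: "'a \<Rightarrow> ennreal"
  assumes "(\<Sum>\<^sub>\<infinity>x\<in>A. f x) < \<infinity>"
  shows "countable {x\<in>A. f x \<noteq> 0}"
proof -
  have "finite {x\<in>A. ennreal (inverse (real (Suc n))) \<le> f x}" (is "finite (?S n)") for n
  proof (rule ccontr)
    assume inf: "infinite (?S n)"
    have pos: "0 < ennreal (inverse (real (Suc n)))"
      by simp
    have "\<infinity> = (\<Sum>\<^sub>\<infinity>x\<in>?S n. f x)"
      using infsum_superconst_infinite_ennreal[OF _ pos inf, of f] by auto
    also have "\<dots> \<le> (\<Sum>\<^sub>\<infinity>x\<in>A. f x)"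
      by (rule infsum_mono_neutral) auto
    finally show False using assms by auto
  qed
  then have "countable (\<Union>n. ?S n)"
    by (simp add: countable_finite)
  moreover have "{x\<in>A. f x \<noteq> 0} \<subseteq> (\<Union>n. ?S n)"
  proof
    fix x assume x: "x \<in> {x\<in>A. f x \<noteq> 0}"
    have "\<exists>n. ennreal (inverse (real (Suc n))) \<le> f x"
    proof (cases "f x")
      case (real u)
      then obtain n where "inverse (real (Suc n)) < u"
        using x reals_Archimedean[of u] by (auto simp: le_less)
      then show ?thesis using real by (intro exI[of _ n]) (simp add: ennreal_leI)
    qed simp
    then show "x \<in> (\<Union>n. ?S n)" using x by auto
  qed
  ultimately show ?thesis by (rule countable_subset[rotated])
qed

text \<open>Bridge that makes interchange theorems for integrals available for sums. One inequality
  is monotone convergence along the finite initial segments of an enumeration of \<open>A\<close>,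
  the other compares with each finite partial sum.\<close>

lemma nn_integral_count_space_eq_infsum:
  fixes f :: "'a \<Rightarrow> ennreal"
  assumes "countable A"
  shows "(\<integral>\<^sup>+x. f x \<partial>count_space A) = (\<Sum>\<^sub>\<infinity>x\<in>A. f x)"
proof (cases "A = {}")
  case False
  define F where "F n = from_nat_into A ` {..n}" for n :: nat
  have F: "finite (F n)" "F n \<subseteq> A" for n
    using from_nat_into[OF False] by (auto simp: F_def)
  have UF: "\<exists>n. x \<in> F n" if "x \<in> A" for x
    using from_nat_into_surj[OF assms that] by (auto simp: F_def)
  have inc: "incseq (\<lambda>n x. f x * indicator (F n) x)"
    by (auto simp: incseq_def le_fun_def F_def indicator_def)
  have "(\<integral>\<^sup>+x. f x \<partial>count_space A) = (\<integral>\<^sup>+x. (SUP n. f x * indicator (F n) x) \<partial>count_space A)"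
  proof (rule nn_integral_cong)
    fix x assume "x \<in> space (count_space A)"
    then obtain n where "x \<in> F n" using UF by auto
    then show "f x = (SUP n. f x * indicator (F n) x)"
      by (intro antisym SUP_upper2[of n] SUP_least) (auto simp: indicator_def)
  qed
  also have "\<dots> = (SUP n. \<integral>\<^sup>+x. f x * indicator (F n) x \<partial>count_space A)"
    using inc by (rule nn_integral_monotone_convergence_SUP) simp
  also have "\<dots> = (SUP n. sum f (F n))"
  proof (rule SUP_cong)
    fix n
    have "(\<integral>\<^sup>+x. f x * indicator (F n) x \<partial>count_space A) = (\<Sum>x\<in>F n. f x * indicator (F n) x)"
      using F by (intro nn_integral_count_space') auto
    then show "(\<integral>\<^sup>+x. f x * indicator (F n) x \<partial>count_space A) = sum f (F n)"
      by simp
  qed simp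
  also have "\<dots> \<le> (\<Sum>\<^sub>\<infinity>x\<in>A. f x)"
    using F by (intro SUP_least) (auto simp: nonneg_infsum_complete intro!: SUP_upper)
  finally have le: "(\<integral>\<^sup>+x. f x \<partial>count_space A) \<le> (\<Sum>\<^sub>\<infinity>x\<in>A. f x)" .
  have "sum f G \<le> (\<integral>\<^sup>+x. f x \<partial>count_space A)" if "finite G" "G \<subseteq> A" for G
  proof -
    have "sum f G = (\<Sum>x\<in>G. f x * indicator G x)" by simp
    also have "\<dots> = (\<integral>\<^sup>+x. f x * indicator G x \<partial>count_space A)"
      using that by (intro nn_integral_count_space'[symmetric]) auto
    also have "\<dots> \<le> (\<integral>\<^sup>+x. f x \<partial>count_space A)"
      by (intro nn_integral_mono) (auto simp: indicator_def)
    finally show ?thesis .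
  qed
  then have "(\<Sum>\<^sub>\<infinity>x\<in>A. f x) \<le> (\<integral>\<^sup>+x. f x \<partial>count_space A)"
    by (auto simp: nonneg_infsum_complete intro!: SUP_least)
  with le show ?thesis by (rule antisym)
qed (simp add: nn_integral_count_space_finite)

text \<open>The index set may be uncountable, where termwise integration can fail. The terms outside
  the countable set \<open>B\<close> vanish identically, so only the interchange with the counting
  measure on \<open>B\<close> is needed, and measurability only there.\<close>

lemma nn_integral_infsum:
  fixes f :: "'c \<Rightarrow> 'a \<Rightarrow> ennreal"
  assumes "countable B" "B \<subseteq> A"
    and "\<And>c. c \<in> B \<Longrightarrow> f c \<in> borel_measurable M"
    and zero: "\<And>c x. c \<in> A - B \<Longrightarrow> x \<in> space M \<Longrightarrow> f c x = 0"
  shows "(\<integral>\<^sup>+x. (\<Sum>\<^sub>\<infinity>c\<in>A. f c x) \<partial>M) = (\<Sum>\<^sub>\<infinity>c\<in>A. \<integral>\<^sup>+x. f c x \<partial>M)"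
proof -
  have "(\<integral>\<^sup>+x. (\<Sum>\<^sub>\<infinity>c\<in>A. f c x) \<partial>M) = (\<integral>\<^sup>+x. (\<integral>\<^sup>+c. f c x \<partial>count_space B) \<partial>M)"
    using assms(2) zero
    by (intro nn_integral_cong, subst nn_integral_count_space_eq_infsum[OF assms(1)])
      (intro infsum_cong_neutral, auto)
  also have "\<dots> = (\<integral>\<^sup>+c. (\<integral>\<^sup>+x. f c x \<partial>M) \<partial>count_space B)"
    using assms by (intro nn_integral_count_space_nn_integral) auto
  also have "\<dots> = (\<Sum>\<^sub>\<infinity>c\<in>B. \<integral>\<^sup>+x. f c x \<partial>M)"
    by (rule nn_integral_count_space_eq_infsum[OF assms(1)])
  also have "\<dots> = (\<Sum>\<^sub>\<infinity>c\<in>A. \<integral>\<^sup>+x. f c x \<partial>M)"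
    using assms(2) zero by (intro infsum_cong_neutral) (auto simp: nn_integral_0_iff_AE cong: nn_integral_cong)
  finally show ?thesis .
qed

subsection \<open>Product measures\<close>

text \<open>A finite product of sigma-finite measures is determined by its values on boxes, and
  renaming the coordinates sends boxes to boxes with the same sides. It will drop the label from
  coordinates \<open>(i, l)\<close> with fixed \<open>l\<close>.\<close>

lemma distr_PiM_reindex_sigma_finite:
  fixes f :: "'i \<Rightarrow> 'j"
  assumes N: "sigma_finite_measure N" and J: "finite J" and f: "bij_betw f I J"
  shows "distr (\<Pi>\<^sub>M j\<in>J. N) (\<Pi>\<^sub>M i\<in>I. N) (\<lambda>x. \<lambda>i\<in>I. x (f i)) = (\<Pi>\<^sub>M i\<in>I. N)"
proof -
  interpret I: product_sigma_finite "\<lambda>_::'i. N"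
    using N by (simp add: product_sigma_finite_def)
  interpret J: product_sigma_finite "\<lambda>_::'j. N"
    using N by (simp add: product_sigma_finite_def)
  have fin: "finite I" and inj: "inj_on f I" and im: "f ` I = J"
    using f J by (auto simp: bij_betw_def bij_betw_finite)
  have meas [measurable]: "(\<lambda>x. \<lambda>i\<in>I. x (f i)) \<in> measurable (\<Pi>\<^sub>M j\<in>J. N) (\<Pi>\<^sub>M i\<in>I. N)"
    using im by (intro measurable_restrict measurable_component_singleton) auto
  show ?thesis
  proof (rule I.PiM_eqI)
    fix A assume A: "\<And>i. i \<in> I \<Longrightarrow> A i \<in> sets N"
    \<comment> \<open>The same box in the coordinates \<open>J\<close>: side \<open>A i\<close> sits
      at coordinate \<open>f i\<close>.\<close>
    define A' where "A' j = A (inv_into I f j)" for j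
    have A'f: "A' (f i) = A i" if "i \<in> I" for i
      using that inj by (simp add: A'_def)
    have sub: "A i \<subseteq> space N" if "i \<in> I" for i
      using A[OF that] by (rule sets.sets_into_space)
    have "(\<lambda>x. \<lambda>i\<in>I. x (f i)) -` Pi\<^sub>E I A \<inter> space (\<Pi>\<^sub>M j\<in>J. N) = Pi\<^sub>E J A'"
    proof (rule set_eqI)
      fix x
      have "x \<in> Pi\<^sub>E J A' \<longleftrightarrow> x \<in> extensional J \<and> (\<forall>i\<in>I. x (f i) \<in> A i)"
        by (auto simp: PiE_iff im[symmetric] A'f)
      then show "x \<in> (\<lambda>x. \<lambda>i\<in>I. x (f i)) -` Pi\<^sub>E I A \<inter> space (\<Pi>\<^sub>M j\<in>J. N) \<longleftrightarrow> x \<in> Pi\<^sub>E J A'"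
        using sub by (auto simp: space_PiM PiE_iff im[symmetric])
    qed
    moreover have "A' j \<in> sets N" if "j \<in> J" for j
      using that A im A'f by force
    ultimately have "emeasure (distr (\<Pi>\<^sub>M j\<in>J. N) (\<Pi>\<^sub>M i\<in>I. N) (\<lambda>x. \<lambda>i\<in>I. x (f i))) (Pi\<^sub>E I A)
        = (\<Prod>j\<in>J. emeasure N (A' j))"
      using A fin J by (simp add: emeasure_distr sets_PiM_I_finite J.emeasure_PiM)
    also have "\<dots> = (\<Prod>i\<in>I. emeasure N (A i))"
      unfolding im[symmetric] by (subst prod.reindex[OF inj]) (simp add: A'f)
    finally show "emeasure (distr (\<Pi>\<^sub>M j\<in>J. N) (\<Pi>\<^sub>M i\<in>I. N) (\<lambda>x. \<lambda>i\<in>I. x (f i))) (Pi\<^sub>E I A)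
        = (\<Prod>i\<in>I. emeasure N (A i))" .
  qed (use fin in auto)
qed

text \<open>Independence of disjoint coordinate blocks: one block at a time is split off by Tonelli,
  and its factor does not see the remaining coordinates.\<close>

lemma nn_integral_PiM_prod_disjoint:
  fixes f :: "'l \<Rightarrow> ('i \<Rightarrow> 'a) \<Rightarrow> ennreal"
  assumes N: "sigma_finite_measure N" and "finite U" "\<And>l. l \<in> U \<Longrightarrow> finite (S l)"
    and "disjoint_family_on S U"
    and "\<And>l. l \<in> U \<Longrightarrow> f l \<in> borel_measurable (\<Pi>\<^sub>M i\<in>S l. N)"
  shows "(\<integral>\<^sup>+x. (\<Prod>l\<in>U. f l (restrict x (S l))) \<partial>(\<Pi>\<^sub>M i\<in>(\<Union>l\<in>U. S l). N))
    = (\<Prod>l\<in>U. \<integral>\<^sup>+x. f l x \<partial>(\<Pi>\<^sub>M i\<in>S l. N))"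
  using assms(2-)
proof (induction U)
  case empty
  show ?case by (simp add: PiM_empty nn_integral_count_space_finite)
next
  case (insert a U)
  interpret product_sigma_finite "\<lambda>_. N"
    using N by (simp add: product_sigma_finite_def)
  let ?R = "\<Union>l\<in>U. S l"
  have dis: "S a \<inter> ?R = {}" and fin: "finite (S a)" "finite ?R"
    using insert.hyps insert.prems by (auto simp: disjoint_family_on_def)
  have fm [measurable]: "f l \<in> borel_measurable (\<Pi>\<^sub>M i\<in>S l. N)" if "l \<in> insert a U" for l
    using insert.prems that by auto
  have comp: "(\<lambda>x. f l (restrict x (S l))) \<in> borel_measurable (\<Pi>\<^sub>M i\<in>K. N)"
    if "l \<in> insert a U" "S l \<subseteq> K" for l K
    using measurable_compose[OF measurable_restrict_subset[OF that(2)] fm[OF that(1)]] .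
  have "(\<integral>\<^sup>+x. (\<Prod>l\<in>insert a U. f l (restrict x (S l))) \<partial>(\<Pi>\<^sub>M i\<in>(\<Union>l\<in>insert a U. S l). N))
      = (\<integral>\<^sup>+x. (\<Prod>l\<in>insert a U. f l (restrict x (S l))) \<partial>(\<Pi>\<^sub>M i\<in>S a \<union> ?R. N))"
    by simp
  also have "\<dots> = (\<integral>\<^sup>+x. (\<integral>\<^sup>+y. (\<Prod>l\<in>insert a U. f l (restrict (merge (S a) ?R (x, y)) (S l)))
      \<partial>(\<Pi>\<^sub>M i\<in>?R. N)) \<partial>(\<Pi>\<^sub>M i\<in>S a. N))"
    by (rule product_nn_integral_fold[OF dis fin], rule borel_measurable_prod_ennreal, rule comp) auto
  also have "\<dots> = (\<integral>\<^sup>+x. (\<integral>\<^sup>+y. f a x * (\<Prod>l\<in>U. f l (restrict y (S l)))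
      \<partial>(\<Pi>\<^sub>M i\<in>?R. N)) \<partial>(\<Pi>\<^sub>M i\<in>S a. N))"
  proof (intro nn_integral_cong)
    fix x y assume "x \<in> space (\<Pi>\<^sub>M i\<in>S a. N)"
    then have "restrict (merge (S a) ?R (x, y)) (S a) = x"
      using dis by (simp add: space_PiM PiE_def extensional_restrict)
    moreover have "restrict (merge (S a) ?R (x, y)) (S l) = restrict y (S l)" if "l \<in> U" for l
      using dis that by (auto simp: merge_def restrict_def fun_eq_iff)
    ultimately show "(\<Prod>l\<in>insert a U. f l (restrict (merge (S a) ?R (x, y)) (S l)))
        = f a x * (\<Prod>l\<in>U. f l (restrict y (S l)))"
      using insert.hyps by simp
  qed
  also have "\<dots> = (\<integral>\<^sup>+x. f a x * (\<integral>\<^sup>+y. (\<Prod>l\<in>U. f l (restrict y (S l)))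
      \<partial>(\<Pi>\<^sub>M i\<in>?R. N)) \<partial>(\<Pi>\<^sub>M i\<in>S a. N))"
    by (intro nn_integral_cong nn_integral_cmult borel_measurable_prod_ennreal comp) auto
  also have "\<dots> = (\<integral>\<^sup>+x. f a x \<partial>(\<Pi>\<^sub>M i\<in>S a. N)) * (\<integral>\<^sup>+y. (\<Prod>l\<in>U. f l (restrict y (S l)))
      \<partial>(\<Pi>\<^sub>M i\<in>?R. N))"
    by (intro nn_integral_multc fm) auto
  also have "(\<integral>\<^sup>+y. (\<Prod>l\<in>U. f l (restrict y (S l))) \<partial>(\<Pi>\<^sub>M i\<in>?R. N))
      = (\<Prod>l\<in>U. \<integral>\<^sup>+x. f l x \<partial>(\<Pi>\<^sub>M i\<in>S l. N))"
    using insert.prems by (intro insert.IH) (auto simp: disjoint_family_on_def)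
  finally show ?case using insert.hyps by simp
qed

subsection \<open>Label sequences and states\<close>

lemma labels_states_of_labels:
  "i \<in> {j..k} \<Longrightarrow> labels (states_of_labels j k I x i) = I i"
  by (auto simp: labels_def states_of_labels_def image_image)

lemma labels_seq_states_of_labels:
  assumes "I \<in> label_seqs \<MM> j k"
  shows "labels_seq j k (states_of_labels j k I x) = I"
proof
  fix i
  show "labels_seq j k (states_of_labels j k I x) i = I i"
    using assms
    by (cases "i \<in> {j..k}")
      (auto simp: labels_seq_def labels_states_of_labels label_seqs_def PiE_iff extensional_def)
qed

lemma state_of_states_of_labels:
  assumes "i \<in> {j..k}" "l \<in> I i"
  shows "state_of (states_of_labels j k I x i) l = x (i, l)"
  using assms by (auto simp: state_of_def states_of_labels_def)

lemma states_of_labels_in_mstate_seqs: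
  assumes "I \<in> label_seqs \<MM> j k" "x \<in> space (\<Pi>\<^sub>M il\<in>Sigma {j..k} I. refM \<MM>)"
  shows "states_of_labels j k I x \<in> mstate_seqs \<MM> j k"
proof -
  have "(\<lambda>l. (x (i, l), l)) ` I i \<in> mstates \<MM> i" if i: "i \<in> {j..k}" for i
  proof -
    have "I i \<in> Fpow (label_space \<MM> i)"
      using assms(1) i by (auto simp: label_seqs_def)
    moreover have "x (i, l) \<in> space (refM \<MM>)" if "l \<in> I i" for l
      using assms(2) i that by (auto simp: space_PiM)
    ultimately show ?thesis
      by (auto simp: mstates_def Fpow_def)
  qed
  then show ?thesis
    by (auto simp: mstate_seqs_def states_of_labels_def)
qed

lemma distinct_ind_seq_states_of_labels: "distinct_ind_seq j k (states_of_labels j k I x) = 1"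
proof -
  have "distinct_ind (states_of_labels j k I x i) = 1" if "i \<in> {j..k}" for i
    using that
    by (auto simp: distinct_ind_def labels_states_of_labels)
      (auto simp: states_of_labels_def card_image inj_on_def)
  then show ?thesis by (simp add: distinct_ind_seq_def)
qed

lemma distinct_ind_seq_cases:
  obtains "distinct_ind_seq j k X = 0"
  | "distinct_ind_seq j k X = 1" "\<And>i. i \<in> {j..k} \<Longrightarrow> distinct_ind (X i) = 1"
proof (cases "\<forall>i\<in>{j..k}. distinct_ind (X i) = 1")
  case True
  then show ?thesis using that(2) by (simp add: distinct_ind_seq_def)
next
  case False
  then have "\<exists>i\<in>{j..k}. distinct_ind (X i) = 0"
    by (auto simp: distinct_ind_def)
  then show ?thesis using that(1) by (simp add: distinct_ind_seq_def)
qed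

lemma finite_label_seqs:
  assumes "mo_system_model \<MM>"
  shows "finite (label_seqs \<MM> j k)"
  using assms
  by (auto simp: label_seqs_def label_space_def mo_system_model_def Fpow_Pow_finite intro!: finite_PiE)

lemma label_seqs_restrict:
  "I \<in> label_seqs \<MM> j k \<Longrightarrow> k' \<le> k \<Longrightarrow> restrict I {j..k'} \<in> label_seqs \<MM> j k'"
  by (auto simp: label_seqs_def PiE_iff)

lemma end_time_le:
  assumes "start_time j l \<le> k"
  shows "end_time j k I l \<le> k"
proof -
  have "(\<Sum>i\<in>{start_time j l + 1..k}. indicator (I i) l) \<le> (\<Sum>i\<in>{start_time j l + 1..k}. 1::nat)"
    by (intro sum_mono) (auto simp: indicator_def)
  then show ?thesis using assms by (simp add: end_time_def)
qed

lemma start_time_le_end_time: "start_time j l \<le> end_time j k I l"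
  by (simp add: end_time_def)

text \<open>Sharper than the definition: the bound \<open>i \<le> k\<close> follows from the
  right-hand side, because a label that occurs has start time at most \<open>k\<close> and hence end
  time at most \<open>k\<close>. So the occurrence times of \<open>l\<close> are exactly an
  interval, as the reindexing of the product measure requires.\<close>

lemma trajectory_labels_iff:
  assumes "trajectory_labels j k I" "l \<in> (\<Union>i\<in>{j..k}. I i)"
  shows "i \<in> {j..k} \<and> l \<in> I i \<longleftrightarrow> i \<in> {start_time j l..end_time j k I l}"
proof -
  obtain i' where i': "i' \<in> {j..k}" "l \<in> I i'" using assms(2) by blast
  have *: "\<forall>i\<in>{j..k}. l \<in> I i \<longleftrightarrow> start_time j l \<le> i \<and> i \<le> end_time j k I l"
    using assms unfolding trajectory_labels_def by (rule bspec)
  with i' have "start_time j l \<le> k"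
    by (meson atLeastAtMost_iff order_trans)
  from end_time_le[OF this, of I] show ?thesis
    using * by (auto simp: start_time_def)
qed

text \<open>Absence of gaps is essential here: at a time where \<open>l\<close> is missing,
  \<open>state_of\<close> would be an unspecified \<open>THE\<close> value instead of a coordinate
  of \<open>x\<close>.\<close>

lemma multiscan_exp_states_of_labels:
  assumes I: "I \<in> label_seqs \<MM> j k" "trajectory_labels j k I"
  shows "multiscan_exp j k h (states_of_labels j k I x) =
    (\<Prod>l\<in>(\<Union>i\<in>{j..k}. I i). h (end_time j k I l)
       (\<lambda>i\<in>{start_time j l..end_time j k I l}. x (i, l)) l)"
  unfolding multiscan_exp_def Let_def labels_seq_states_of_labels[OF I(1)]
proof (rule prod.cong)
  fix l assume l: "l \<in> (\<Union>i\<in>{j..k}. I i)"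
  have "state_of (states_of_labels j k I x i) l = x (i, l)"
    if "i \<in> {start_time j l..end_time j k I l}" for i
    using trajectory_labels_iff[OF I(2) l, of i] that by (intro state_of_states_of_labels) auto
  then show "h (end_time j k I l)
      (\<lambda>i\<in>{start_time j l..end_time j k I l}. state_of (states_of_labels j k I x i) l) l =
    h (end_time j k I l) (\<lambda>i\<in>{start_time j l..end_time j k I l}. x (i, l)) l"
    by (simp cong: restrict_cong)
qed (auto simp: labels_states_of_labels)

text \<open>Transposes the index set \<open>Sigma {j..k} I\<close>: it is grouped by time, while the
  integrand is a product over labels. For trajectory label sequences the fibre over each label is
  its interval of times, so the fibres are disjoint blocks of coordinates, each factor uses one
  block, and reindexing turns that block into the domain of a trajectory density.\<close>

lemma
  assumes N: "sigma_finite_measure (refM \<MM>)"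
    and I: "I \<in> label_seqs \<MM> j k" "trajectory_labels j k I"
    and h: "\<And>l. l \<in> (\<Union>i\<in>{j..k}. I i) \<Longrightarrow>
      (\<lambda>x. h (end_time j k I l) x l)
        \<in> borel_measurable (\<Pi>\<^sub>M i\<in>{start_time j l..end_time j k I l}. refM \<MM>)"
  shows measurable_multiscan_exp: "(\<lambda>x. multiscan_exp j k h (states_of_labels j k I x))
      \<in> borel_measurable (\<Pi>\<^sub>M il\<in>Sigma {j..k} I. refM \<MM>)" (is ?meas)
    and nn_integral_multiscan_exp:
      "(\<integral>\<^sup>+x. multiscan_exp j k h (states_of_labels j k I x) \<partial>(\<Pi>\<^sub>M il\<in>Sigma {j..k} I. refM \<MM>))
        = (\<Prod>l\<in>(\<Union>i\<in>{j..k}. I i). \<integral>\<^sup>+x. h (end_time j k I l) x l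
             \<partial>(\<Pi>\<^sub>M i\<in>{start_time j l..end_time j k I l}. refM \<MM>))" (is ?int)
proof -
  let ?U = "\<Union>i\<in>{j..k}. I i"
  define T where "T l = {start_time j l..end_time j k I l}" for l
  define S where "S l = (\<lambda>i. (i, l)) ` T l" for l :: "'b label"
  define f where "f l x = h (end_time j k I l) (\<lambda>i\<in>T l. x (i, l)) l" for l x
  note h = h[folded T_def]
  have bij: "bij_betw (\<lambda>i. (i, l)) (T l) (S l)" and fin: "finite (S l)" for l
    by (auto simp: bij_betw_def inj_on_def S_def T_def)
  have finU: "finite ?U"
    using I(1) by (auto simp: label_seqs_def Fpow_def PiE_iff)
  have Sigma: "Sigma {j..k} I = (\<Union>l\<in>?U. S l)"
  proof -
    have "(i, l) \<in> Sigma {j..k} I \<longleftrightarrow> (i, l) \<in> (\<Union>l\<in>?U. S l)" for i l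
    proof -
      have "(i, l) \<in> (\<Union>l\<in>?U. S l) \<longleftrightarrow> l \<in> ?U \<and> i \<in> T l"
        unfolding S_def by blast
      also have "\<dots> \<longleftrightarrow> i \<in> {j..k} \<and> l \<in> I i"
        using trajectory_labels_iff[OF I(2), of l i] unfolding T_def by blast
      finally show ?thesis by (simp only: mem_Sigma_iff)
    qed
    then show ?thesis by (intro set_eqI) (simp only: split_paired_all)
  qed
  have re [measurable]: "(\<lambda>x. \<lambda>i\<in>T l. x (i, l)) \<in> measurable (\<Pi>\<^sub>M il\<in>S l. refM \<MM>) (\<Pi>\<^sub>M i\<in>T l. refM \<MM>)" for l
    by (intro measurable_restrict measurable_component_singleton) (auto simp: S_def)
  have fm: "f l \<in> borel_measurable (\<Pi>\<^sub>M il\<in>S l. refM \<MM>)" if "l \<in> ?U" for l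
    unfolding f_def using measurable_compose[OF re h[OF that]] .
  have eq: "multiscan_exp j k h (states_of_labels j k I x) = (\<Prod>l\<in>?U. f l (restrict x (S l)))" for x
    unfolding multiscan_exp_states_of_labels[OF I] f_def T_def[symmetric]
    by (intro prod.cong refl arg_cong2[where f = "h _"]) (auto simp: S_def fun_eq_iff)
  have "(\<lambda>x. f l (restrict x (S l))) \<in> borel_measurable (\<Pi>\<^sub>M il\<in>(\<Union>l\<in>?U. S l). refM \<MM>)"
    if "l \<in> ?U" for l
    using that by (intro measurable_compose[OF measurable_restrict_subset fm]) auto
  then show ?meas
    unfolding eq Sigma by (intro borel_measurable_prod_ennreal) auto
  have "(\<integral>\<^sup>+x. multiscan_exp j k h (states_of_labels j k I x) \<partial>(\<Pi>\<^sub>M il\<in>Sigma {j..k} I. refM \<MM>))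
      = (\<Prod>l\<in>?U. \<integral>\<^sup>+x. f l x \<partial>(\<Pi>\<^sub>M il\<in>S l. refM \<MM>))"
    unfolding eq Sigma
    by (rule nn_integral_PiM_prod_disjoint[OF N finU fin _ fm])
      (auto simp: disjoint_family_on_def S_def)
  also have "\<dots> = (\<Prod>l\<in>?U. \<integral>\<^sup>+x. h (end_time j k I l) x l \<partial>(\<Pi>\<^sub>M i\<in>T l. refM \<MM>))"
  proof (rule prod.cong)
    fix l assume l: "l \<in> ?U"
    show "(\<integral>\<^sup>+x. f l x \<partial>(\<Pi>\<^sub>M il\<in>S l. refM \<MM>))
        = (\<integral>\<^sup>+x. h (end_time j k I l) x l \<partial>(\<Pi>\<^sub>M i\<in>T l. refM \<MM>))"
      using nn_integral_distr[OF re, of "\<lambda>x. h (end_time j k I l) x l" l] h[OF l]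
      unfolding f_def by (simp add: distr_PiM_reindex_sigma_finite[OF N fin bij])
  qed simp
  finally show ?int unfolding T_def .
qed

subsection \<open>The unnormalised trajectory densities\<close>

text \<open>The numerators of \<open>update_density\<close> for one component, with \<open>h\<close>
  in place of \<open>p \<xi>\<close> and the same order of cases.\<close>

definition step_num ::
    "('x, 'a, 'z) mo_system \<Rightarrow> nat \<Rightarrow> (nat \<Rightarrow> 'z) \<Rightarrow> ('x, 'a) traj_fun \<Rightarrow> ('a label \<Rightarrow> nat option) \<Rightarrow>
     ('x, 'a) traj_fun" where
  "step_num \<MM> k z h \<theta> t x l =
     (if start_time 0 l = k then Lambda_B \<MM> k z (the (\<theta> l)) (x k) l
      else if t = k then
        Lambda_S \<MM> k z (the (\<theta> l)) (x k) (x (k - 1)) l *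
        h (k - 1) (restrict x {start_time 0 l..k - 1}) l
      else if t = k - 1 then
        QS \<MM> (k - 1) (x (k - 1)) l * h (k - 1) (restrict x {start_time 0 l..k - 1}) l
      else h t x l)"

text \<open>The value 1 for trajectories that ended before \<open>k - 1\<close> makes
  \<open>normalised\<close> act as the identity there, so one quotient formula covers all four
  cases.\<close>

definition step_den ::
    "('x, 'a, 'z) mo_system \<Rightarrow> nat \<Rightarrow> (nat \<Rightarrow> 'z) \<Rightarrow> ('x, 'a) traj_fun \<Rightarrow> ('a label \<Rightarrow> nat option) \<Rightarrow>
     nat \<Rightarrow> 'a label \<Rightarrow> ennreal" where
  "step_den \<MM> k z h \<theta> t l =
     (if start_time 0 l = k then Lambda_B_bar \<MM> k z (the (\<theta> l)) l
      else if t = k then Lambda_S_bar \<MM> k z h (the (\<theta> l)) l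
      else if t = k - 1 then QS_bar \<MM> k h l
      else 1)"

lemma update_density_eq_normalised:
  "update_density \<MM> k z r p (\<xi>, \<theta>) t x l =
     normalised (r (\<xi>, \<theta>) t x l) (step_num \<MM> k z (p \<xi>) \<theta> t x l) (step_den \<MM> k z (p \<xi>) \<theta> t l)"
  by (simp add: update_density_def step_num_def step_den_def normalised_def Let_def divide_ennreal_def)

lemma start_time_0 [simp]: "start_time 0 l = fst l"
  by (simp add: start_time_def)

lemma sigma_finite_refM: "mo_system_model \<MM> \<Longrightarrow> sigma_finite_measure (refM \<MM>)"
  by (simp add: mo_system_model_def)

lemma finite_births: "mo_system_model \<MM> \<Longrightarrow> finite (births \<MM> s)"
  unfolding mo_system_model_def by blast

lemma births_fst:
  assumes "mo_system_model \<MM>" "l \<in> births \<MM> s"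
  shows "fst l = s"
  using assms unfolding mo_system_model_def by blast

lemma label_space_iff:
  assumes "mo_system_model \<MM>"
  shows "l \<in> label_space \<MM> k \<longleftrightarrow> fst l \<le> k \<and> l \<in> births \<MM> (fst l)"
proof
  assume "l \<in> label_space \<MM> k"
  then obtain s where s: "s \<le> k" "l \<in> births \<MM> s"
    unfolding label_space_def by auto
  with births_fst[OF assms s(2)] show "fst l \<le> k \<and> l \<in> births \<MM> (fst l)" by simp
qed (unfold label_space_def, blast intro: atLeastAtMost_iff[THEN iffD2])

lemma births_iff:
  assumes "mo_system_model \<MM>"
  shows "l \<in> births \<MM> k \<longleftrightarrow> fst l = k \<and> l \<in> label_space \<MM> k"
  using births_fst[OF assms, of l k] unfolding label_space_iff[OF assms] by blast

lemma measurable_psi: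
  assumes "mo_system_model \<MM>" "l \<in> label_space \<MM> k"
  shows "(\<lambda>x. psi \<MM> k z j x l) \<in> borel_measurable (refM \<MM>)"
proof -
  have [measurable]: "(\<lambda>x. PD \<MM> k x l) \<in> borel_measurable (refM \<MM>)"
    "(\<lambda>x. gD \<MM> k (z j) x l) \<in> borel_measurable (refM \<MM>)"
    using assms unfolding mo_system_model_def by blast+
  show ?thesis unfolding psi_def by measurable
qed

lemma measurable_Lambda_B:
  assumes "mo_system_model \<MM>" "l \<in> births \<MM> k"
  shows "(\<lambda>x. Lambda_B \<MM> k z j x l) \<in> borel_measurable (refM \<MM>)"
proof -
  have [measurable]: "(\<lambda>x. fB \<MM> k x l) \<in> borel_measurable (refM \<MM>)"
    using assms unfolding mo_system_model_def by blast
  have [measurable]: "(\<lambda>x. psi \<MM> k z j x l) \<in> borel_measurable (refM \<MM>)"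
    using assms(2) unfolding births_iff[OF assms(1)] by (intro measurable_psi[OF assms(1)]) simp
  show ?thesis unfolding Lambda_B_def by measurable
qed

lemma measurable_QS:
  assumes "mo_system_model \<MM>" "l \<in> label_space \<MM> n"
  shows "(\<lambda>x. QS \<MM> n x l) \<in> borel_measurable (refM \<MM>)"
proof -
  have [measurable]: "(\<lambda>x. PS \<MM> n x l) \<in> borel_measurable (refM \<MM>)"
    using assms unfolding mo_system_model_def by blast+
  show ?thesis unfolding QS_def by measurable
qed

lemma measurable_Lambda_S:
  assumes "mo_system_model \<MM>" "l \<in> label_space \<MM> n"
  shows "(\<lambda>(x, \<zeta>). Lambda_S \<MM> (Suc n) z j x \<zeta> l) \<in> borel_measurable (refM \<MM> \<Otimes>\<^sub>M refM \<MM>)"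
proof -
  have [measurable]: "(\<lambda>x. PS \<MM> n x l) \<in> borel_measurable (refM \<MM>)"
    "(\<lambda>(x, \<zeta>). fS \<MM> (Suc n) x \<zeta> l) \<in> borel_measurable (refM \<MM> \<Otimes>\<^sub>M refM \<MM>)"
    using assms unfolding mo_system_model_def by blast+
  have [measurable]: "(\<lambda>x. psi \<MM> (Suc n) z j x l) \<in> borel_measurable (refM \<MM>)"
    using assms by (intro measurable_psi) (simp_all add: label_space_iff)
  show ?thesis unfolding Lambda_S_def by (simp add: split_beta) measurable
qed

context
  fixes \<MM> :: "('x, 'a, 'z) mo_system" and n :: nat and h :: "('x, 'a) traj_fun" and l :: "'a label"
  assumes model: "mo_system_model \<MM>" and h: "traj_densities \<MM> 0 n h" and l: "l \<in> label_space \<MM> n"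
begin

interpretation product_sigma_finite "\<lambda>_::nat. refM \<MM>"
  using sigma_finite_refM[OF model] by (simp add: product_sigma_finite_def)

private lemma measurable_h [measurable]: "(\<lambda>x. h n x l) \<in> borel_measurable (\<Pi>\<^sub>M i\<in>{fst l..n}. refM \<MM>)"
  using h l model by (simp add: traj_densities_def label_space_iff)

text \<open>The barred quantities integrate against the marginal of the last state only. Tonelli
  with the last coordinate outermost recovers them from integrals over whole trajectories, since
  \<open>\<phi>\<close> is constant in the earlier coordinates.\<close>

lemma nn_integral_marginal_last:
  assumes [measurable]: "\<phi> \<in> borel_measurable (refM \<MM>)"
  shows "(\<integral>\<^sup>+x. \<phi> (x n) * h n x l \<partial>(\<Pi>\<^sub>M i\<in>{fst l..n}. refM \<MM>))
    = (\<integral>\<^sup>+\<zeta>. \<phi> \<zeta> * marginal_last \<MM> n h \<zeta> l \<partial>refM \<MM>)"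
proof -
  have ins: "{fst l..n} = insert n {fst l..<n}"
    using l model by (auto simp add: label_space_iff)
  have "(\<integral>\<^sup>+x. \<phi> (x n) * h n x l \<partial>(\<Pi>\<^sub>M i\<in>{fst l..n}. refM \<MM>))
      = (\<integral>\<^sup>+\<zeta>. (\<integral>\<^sup>+x. \<phi> \<zeta> * h n (x(n := \<zeta>)) l \<partial>(\<Pi>\<^sub>M i\<in>{fst l..<n}. refM \<MM>)) \<partial>refM \<MM>)"
    using measurable_h unfolding ins
    by (subst product_nn_integral_insert_rev) (auto intro!: borel_measurable_times_ennreal)
  also have "\<dots> = (\<integral>\<^sup>+\<zeta>. \<phi> \<zeta> * marginal_last \<MM> n h \<zeta> l \<partial>refM \<MM>)"
  proof (rule nn_integral_cong)
    fix \<zeta> assume "\<zeta> \<in> space (refM \<MM>)"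
    then have "(\<lambda>x. x(n := \<zeta>)) \<in> measurable (\<Pi>\<^sub>M i\<in>{fst l..<n}. refM \<MM>) (\<Pi>\<^sub>M i\<in>{fst l..n}. refM \<MM>)"
      unfolding ins by (intro measurable_fun_upd[where J = "{fst l..<n}"]) auto
    from measurable_compose[OF this measurable_h]
    show "(\<integral>\<^sup>+x. \<phi> \<zeta> * h n (x(n := \<zeta>)) l \<partial>(\<Pi>\<^sub>M i\<in>{fst l..<n}. refM \<MM>))
        = \<phi> \<zeta> * marginal_last \<MM> n h \<zeta> l"
      by (simp add: marginal_last_def nn_integral_cmult)
  qed
  finally show ?thesis .
qed

text \<open>The new coordinate \<open>Suc n\<close> is split off as the outer variable, matching the
  outer integral in \<open>Lambda_S_bar\<close>; for a fixed new state, the inner integral is a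
  marginalisation of the old trajectory density.\<close>

lemma measurable_step_num_survive:
  "(\<lambda>x. Lambda_S \<MM> (Suc n) z j (x (Suc n)) (x n) l * h n (restrict x {fst l..n}) l)
    \<in> borel_measurable (\<Pi>\<^sub>M i\<in>{fst l..Suc n}. refM \<MM>)"
  and nn_integral_step_num_survive:
  "(\<integral>\<^sup>+x. Lambda_S \<MM> (Suc n) z j (x (Suc n)) (x n) l * h n (restrict x {fst l..n}) l
      \<partial>(\<Pi>\<^sub>M i\<in>{fst l..Suc n}. refM \<MM>)) = Lambda_S_bar \<MM> (Suc n) z h j l"
proof -
  have le: "fst l \<le> n" using l model by (simp add: label_space_iff)
  have ins: "{fst l..Suc n} = insert (Suc n) {fst l..n}" using le by auto
  note L [measurable] = measurable_Lambda_S[OF model l, of z j]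
  have "(\<lambda>x. (x (Suc n), x n)) \<in> measurable (\<Pi>\<^sub>M i\<in>{fst l..Suc n}. refM \<MM>) (refM \<MM> \<Otimes>\<^sub>M refM \<MM>)"
    using le by (intro measurable_Pair measurable_component_singleton) auto
  from measurable_compose[OF this L]
  have "(\<lambda>x. Lambda_S \<MM> (Suc n) z j (x (Suc n)) (x n) l)
      \<in> borel_measurable (\<Pi>\<^sub>M i\<in>{fst l..Suc n}. refM \<MM>)" by simp
  moreover have "(\<lambda>x. h n (restrict x {fst l..n}) l)
      \<in> borel_measurable (\<Pi>\<^sub>M i\<in>{fst l..Suc n}. refM \<MM>)"
    by (rule measurable_compose[OF measurable_restrict_subset measurable_h]) simp
  ultimately show meas: "(\<lambda>x. Lambda_S \<MM> (Suc n) z j (x (Suc n)) (x n) l * h n (restrict x {fst l..n}) l)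
      \<in> borel_measurable (\<Pi>\<^sub>M i\<in>{fst l..Suc n}. refM \<MM>)"
    by (rule borel_measurable_times_ennreal)
  have "(\<integral>\<^sup>+x. Lambda_S \<MM> (Suc n) z j (x (Suc n)) (x n) l * h n (restrict x {fst l..n}) l
      \<partial>(\<Pi>\<^sub>M i\<in>{fst l..Suc n}. refM \<MM>))
    = (\<integral>\<^sup>+y. (\<integral>\<^sup>+x. Lambda_S \<MM> (Suc n) z j y (x n) l * h n (restrict (x(Suc n := y)) {fst l..n}) l
      \<partial>(\<Pi>\<^sub>M i\<in>{fst l..n}. refM \<MM>)) \<partial>refM \<MM>)"
    using meas unfolding ins by (subst product_nn_integral_insert_rev) auto
  also have "\<dots> = (\<integral>\<^sup>+y. (\<integral>\<^sup>+x. Lambda_S \<MM> (Suc n) z j y (x n) l * h n x l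
      \<partial>(\<Pi>\<^sub>M i\<in>{fst l..n}. refM \<MM>)) \<partial>refM \<MM>)"
  proof (intro nn_integral_cong)
    fix x y assume "x \<in> space (\<Pi>\<^sub>M i\<in>{fst l..n}. refM \<MM>)"
    then have "restrict (x(Suc n := y)) {fst l..n} = x"
      by (auto simp: space_PiM PiE_def extensional_def fun_eq_iff)
    then show "Lambda_S \<MM> (Suc n) z j y (x n) l * h n (restrict (x(Suc n := y)) {fst l..n}) l
      = Lambda_S \<MM> (Suc n) z j y (x n) l * h n x l" by simp
  qed
  also have "\<dots> = Lambda_S_bar \<MM> (Suc n) z h j l"
    unfolding Lambda_S_bar_def
  proof (intro nn_integral_cong)
    fix y assume "y \<in> space (refM \<MM>)"
    then have "(\<lambda>\<zeta>. Lambda_S \<MM> (Suc n) z j y \<zeta> l) \<in> borel_measurable (refM \<MM>)"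
      using measurable_compose[OF measurable_Pair1' L] by simp
    from nn_integral_marginal_last[OF this]
    show "(\<integral>\<^sup>+x. Lambda_S \<MM> (Suc n) z j y (x n) l * h n x l \<partial>(\<Pi>\<^sub>M i\<in>{fst l..n}. refM \<MM>))
      = (\<integral>\<^sup>+\<zeta>. Lambda_S \<MM> (Suc n) z j y \<zeta> l * marginal_last \<MM> (Suc n - 1) h \<zeta> l \<partial>refM \<MM>)"
      by simp
  qed
  finally show "(\<integral>\<^sup>+x. Lambda_S \<MM> (Suc n) z j (x (Suc n)) (x n) l * h n (restrict x {fst l..n}) l
      \<partial>(\<Pi>\<^sub>M i\<in>{fst l..Suc n}. refM \<MM>)) = Lambda_S_bar \<MM> (Suc n) z h j l" .
qed

text \<open>A dying trajectory gets no new coordinate, so the restriction in the numerator is the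
  identity on the product space and marginalisation applies directly.\<close>

lemma measurable_step_num_die:
  "(\<lambda>x. QS \<MM> n (x n) l * h n (restrict x {fst l..n}) l)
    \<in> borel_measurable (\<Pi>\<^sub>M i\<in>{fst l..n}. refM \<MM>)"
  and nn_integral_step_num_die:
  "(\<integral>\<^sup>+x. QS \<MM> n (x n) l * h n (restrict x {fst l..n}) l \<partial>(\<Pi>\<^sub>M i\<in>{fst l..n}. refM \<MM>))
    = QS_bar \<MM> (Suc n) h l"
proof -
  have le: "fst l \<le> n" using l model by (simp add: label_space_iff)
  note Q [measurable] = measurable_QS[OF model l]
  have "(\<lambda>x. QS \<MM> n (x n) l) \<in> borel_measurable (\<Pi>\<^sub>M i\<in>{fst l..n}. refM \<MM>)"
    using le by (intro measurable_compose[OF _ Q] measurable_component_singleton) simp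
  moreover have "(\<lambda>x. h n (restrict x {fst l..n}) l) \<in> borel_measurable (\<Pi>\<^sub>M i\<in>{fst l..n}. refM \<MM>)"
    by (rule measurable_compose[OF measurable_restrict_subset measurable_h]) simp
  ultimately show "(\<lambda>x. QS \<MM> n (x n) l * h n (restrict x {fst l..n}) l)
      \<in> borel_measurable (\<Pi>\<^sub>M i\<in>{fst l..n}. refM \<MM>)"
    by (rule borel_measurable_times_ennreal)
  have "(\<integral>\<^sup>+x. QS \<MM> n (x n) l * h n (restrict x {fst l..n}) l \<partial>(\<Pi>\<^sub>M i\<in>{fst l..n}. refM \<MM>))
    = (\<integral>\<^sup>+x. QS \<MM> n (x n) l * h n x l \<partial>(\<Pi>\<^sub>M i\<in>{fst l..n}. refM \<MM>))"
    by (intro nn_integral_cong) (simp add: space_PiM PiE_def extensional_restrict)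
  also have "\<dots> = QS_bar \<MM> (Suc n) h l"
    by (simp add: nn_integral_marginal_last[OF Q] QS_bar_def)
  finally show "(\<integral>\<^sup>+x. QS \<MM> n (x n) l * h n (restrict x {fst l..n}) l
      \<partial>(\<Pi>\<^sub>M i\<in>{fst l..n}. refM \<MM>)) = QS_bar \<MM> (Suc n) h l" .
qed

end

text \<open>Each of the four cases is a one-trajectory integral: a single coordinate for a newborn,
  the two preceding computations, and total mass 1 for a trajectory long finished. Membership of
  \<open>l\<close> in the domain of \<theta> is not involved, so the result also covers combinations
  of label and end time that no contributing component realises, as a family of densities
  must.\<close>

lemma step_num_density:
  fixes \<MM> :: "('x, 'a, 'z) mo_system"
  assumes model: "mo_system_model \<MM>" and h: "traj_densities \<MM> 0 n h"
    and l: "l \<in> label_space \<MM> (Suc n)" and t: "fst l \<le> t" "t \<le> Suc n"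
  shows measurable_step_num: "(\<lambda>x. step_num \<MM> (Suc n) z h \<theta> t x l)
      \<in> borel_measurable (\<Pi>\<^sub>M i\<in>{fst l..t}. refM \<MM>)"
    and nn_integral_step_num: "(\<integral>\<^sup>+x. step_num \<MM> (Suc n) z h \<theta> t x l \<partial>(\<Pi>\<^sub>M i\<in>{fst l..t}. refM \<MM>))
      = step_den \<MM> (Suc n) z h \<theta> t l"
proof -
  interpret product_sigma_finite "\<lambda>_::nat. refM \<MM>"
    using sigma_finite_refM[OF model] by (simp add: product_sigma_finite_def)
  have "(\<lambda>x. step_num \<MM> (Suc n) z h \<theta> t x l) \<in> borel_measurable (\<Pi>\<^sub>M i\<in>{fst l..t}. refM \<MM>)
    \<and> (\<integral>\<^sup>+x. step_num \<MM> (Suc n) z h \<theta> t x l \<partial>(\<Pi>\<^sub>M i\<in>{fst l..t}. refM \<MM>)) = step_den \<MM> (Suc n) z h \<theta> t l"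
  proof (cases "fst l = Suc n")
    case True
    then have "l \<in> births \<MM> (Suc n)" using l by (simp add: births_iff[OF model])
    note B = measurable_Lambda_B[OF model this, of z "the (\<theta> l)"]
    have t: "t = Suc n" using t True by simp
    have "(\<lambda>x. Lambda_B \<MM> (Suc n) z (the (\<theta> l)) (x (Suc n)) l)
        \<in> borel_measurable (\<Pi>\<^sub>M i\<in>{Suc n}. refM \<MM>)"
      by (intro measurable_compose[OF _ B] measurable_component_singleton) simp
    then show ?thesis
      using True t product_nn_integral_singleton[OF B, of "Suc n"]
      by (simp add: step_num_def step_den_def Lambda_B_bar_def)
  next
    case False
    then have l': "l \<in> label_space \<MM> n" using l by (simp add: label_space_iff[OF model])
    consider "t = Suc n" | "t = n" | "t < n" using t by linarith
    then show ?thesis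
    proof cases
      case 1
      then show ?thesis
        using False measurable_step_num_survive[OF model h l'] nn_integral_step_num_survive[OF model h l']
        by (simp add: step_num_def step_den_def)
    next
      case 2
      then show ?thesis
        using False measurable_step_num_die[OF model h l'] nn_integral_step_num_die[OF model h l']
        by (simp add: step_num_def step_den_def)
    next
      case 3
      then show ?thesis
        using False h l' t by (simp add: step_num_def step_den_def traj_densities_def)
    qed
  qed
  then show "(\<lambda>x. step_num \<MM> (Suc n) z h \<theta> t x l) \<in> borel_measurable (\<Pi>\<^sub>M i\<in>{fst l..t}. refM \<MM>)"
    and "(\<integral>\<^sup>+x. step_num \<MM> (Suc n) z h \<theta> t x l \<partial>(\<Pi>\<^sub>M i\<in>{fst l..t}. refM \<MM>)) = step_den \<MM> (Suc n) z h \<theta> t l"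
    by blast+
qed

lemma traj_densities_update_density:
  assumes "mo_system_model \<MM>" "traj_densities \<MM> 0 n (p \<xi>)" "traj_densities \<MM> 0 (Suc n) (r (\<xi>, \<theta>))"
  shows "traj_densities \<MM> 0 (Suc n) (update_density \<MM> (Suc n) z r p (\<xi>, \<theta>))"
  unfolding traj_densities_def
proof (intro ballI)
  fix l t assume l: "l \<in> label_space \<MM> (Suc n)" and "t \<in> {start_time 0 l..Suc n}"
  then have t: "fst l \<le> t" "t \<le> Suc n" by auto
  note num = step_num_density[OF assms(1,2) l t, of z \<theta>]
  show "(\<lambda>x. update_density \<MM> (Suc n) z r p (\<xi>, \<theta>) t x l)
        \<in> borel_measurable (\<Pi>\<^sub>M i\<in>{start_time 0 l..t}. refM \<MM>) \<and>
      (\<integral>\<^sup>+x. update_density \<MM> (Suc n) z r p (\<xi>, \<theta>) t x l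
        \<partial>(\<Pi>\<^sub>M i\<in>{start_time 0 l..t}. refM \<MM>)) = 1"
  proof (cases "step_den \<MM> (Suc n) z (p \<xi>) \<theta> t l \<in> {0, \<infinity>}")
    \<comment> \<open>The denominator depends only on the label and the end time, so here the
      density equals \<open>r (\<xi>, \<theta>)\<close> at every point and inherits its
      normalisation.\<close>
    case True
    then show ?thesis
      using assms(3) l t by (auto simp: update_density_eq_normalised normalised_def traj_densities_def)
  next
    case False
    then have eq: "update_density \<MM> (Suc n) z r p (\<xi>, \<theta>) t x l
        = step_num \<MM> (Suc n) z (p \<xi>) \<theta> t x l / step_den \<MM> (Suc n) z (p \<xi>) \<theta> t l" for x
      by (simp add: update_density_eq_normalised normalised_def)
    show ?thesis
      unfolding eq start_time_0 using False num
      by (simp add: nn_integral_divide borel_measurable_divide_ennreal ennreal_divide_self less_top)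
  qed
qed

subsection \<open>Extending label sequences by one step\<close>

context
  fixes \<MM> :: "('x, 'a, 'z) mo_system" and n :: nat and I :: "nat \<Rightarrow> 'a label set"
  assumes model: "mo_system_model \<MM>"
    and I: "I \<in> label_seqs \<MM> 0 (Suc n)"
    and prev: "trajectory_labels 0 n (restrict I {0..n})"
    and sub: "I (Suc n) \<subseteq> births \<MM> (Suc n) \<union> I n"
begin

private lemma fst_le: "i \<le> Suc n \<Longrightarrow> l \<in> I i \<Longrightarrow> fst l \<le> i"
proof -
  assume "i \<le> Suc n" "l \<in> I i"
  then have "l \<in> label_space \<MM> i"
    using I by (auto simp: label_seqs_def Fpow_def PiE_iff)
  then show "fst l \<le> i" by (simp add: label_space_iff[OF model])
qed

private lemma fst_births: "l \<in> births \<MM> (Suc n) \<Longrightarrow> fst l = Suc n"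
  by (rule births_fst[OF model])

private lemma end_time_Suc:
  "fst l \<le> n \<Longrightarrow> end_time 0 (Suc n) I l = end_time 0 n (restrict I {0..n}) l + indicator (I (Suc n)) l"
  by (simp add: end_time_def atLeastAtMostSuc_conv add.commute)

text \<open>For a newborn label the sum in \<open>end_time\<close> ranges over an empty interval, so
  the value is its birth time.\<close>

private lemma end_time_birth: "l \<in> births \<MM> (Suc n) \<Longrightarrow> end_time 0 (Suc n) I l = Suc n"
  using fst_births by (simp add: end_time_def)

private lemma prev_iff:
  assumes "l \<in> (\<Union>i\<in>{0..n}. I i)" "i \<le> n"
  shows "l \<in> I i \<longleftrightarrow> fst l \<le> i \<and> i \<le> end_time 0 n (restrict I {0..n}) l"
  using trajectory_labels_iff[OF prev, of l i] assms by auto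

private lemma prev_end_le:
  assumes "l \<in> (\<Union>i\<in>{0..n}. I i)"
  shows "fst l \<le> n" "end_time 0 n (restrict I {0..n}) l \<le> n"
proof -
  from assms obtain i where "i \<le> n" "l \<in> I i" by auto
  then show "fst l \<le> n" using fst_le[of i l] by simp
  then show "end_time 0 n (restrict I {0..n}) l \<le> n" by (intro end_time_le) simp
qed

private lemma I_n_end: "l \<in> I n \<Longrightarrow> fst l \<le> n \<and> end_time 0 n (restrict I {0..n}) l = n"
proof -
  assume l: "l \<in> I n"
  then have l': "l \<in> (\<Union>i\<in>{0..n}. I i)" by auto
  from prev_iff[OF l', of n] prev_end_le[OF l'] l show ?thesis by simp
qed

private lemma survivor_end: "l \<in> I n \<inter> I (Suc n) \<Longrightarrow> end_time 0 (Suc n) I l = Suc n"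
  using I_n_end[of l] by (simp add: end_time_Suc)

private lemma dead_end: "l \<in> I n - I (Suc n) \<Longrightarrow> end_time 0 (Suc n) I l = n"
  using I_n_end[of l] by (simp add: end_time_Suc)

text \<open>No resurrection: by \<open>sub\<close>, a label present at \<open>Suc n\<close> but
  absent at \<open>n\<close> must be a birth at \<open>Suc n\<close>, which contradicts an earlier
  occurrence.\<close>

lemma end_time_past:
  assumes "l \<in> (\<Union>i\<in>{0..n}. I i) - I n"
  shows "end_time 0 n (restrict I {0..n}) l < n \<and> fst l \<le> n
    \<and> end_time 0 (Suc n) I l = end_time 0 n (restrict I {0..n}) l"
proof -
  have l: "l \<in> (\<Union>i\<in>{0..n}. I i)" "l \<notin> I n" using assms by auto
  note le = prev_end_le[OF l(1)]
  have "l \<notin> I (Suc n)" using sub l(2) fst_births[of l] le(1) by auto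
  then show ?thesis
    using le l(2) prev_iff[OF l(1), of n] by (simp add: end_time_Suc)
qed

text \<open>Newborn, surviving, dying after \<open>n\<close>, gone before \<open>n\<close>: these
  are the four cases of \<open>step_den\<close>, expressed by membership instead of times.\<close>

private lemma union_Suc:
  "(\<Union>i\<in>{0..Suc n}. I i) =
    (births \<MM> (Suc n) \<inter> I (Suc n)) \<union> (I n \<inter> I (Suc n)) \<union> (I n - I (Suc n)) \<union> ((\<Union>i\<in>{0..n}. I i) - I n)"
  using sub by (auto simp: atLeastAtMostSuc_conv)

text \<open>Used directly to integrate over trajectories, and in contrapositive form to show that
  the new weights vanish off trajectory label sequences.\<close>

lemma trajectory_labels_Suc: "trajectory_labels 0 (Suc n) I"
  unfolding trajectory_labels_def
proof (intro ballI)
  fix l i assume l: "l \<in> (\<Union>i\<in>{0..Suc n}. I i)" and i: "i \<in> {0..Suc n}"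
  show "l \<in> I i \<longleftrightarrow> start_time 0 l \<le> i \<and> i \<le> end_time 0 (Suc n) I l"
  proof (cases "l \<in> (\<Union>i\<in>{0..n}. I i)")
    case True
    show ?thesis
    proof (cases "i = Suc n")
      case i: True
      show ?thesis
      proof
        assume "l \<in> I i"
        then have "l \<in> I n \<inter> I (Suc n)"
          using i sub fst_births[of l] prev_end_le(1)[OF True] by auto
        then show "start_time 0 l \<le> i \<and> i \<le> end_time 0 (Suc n) I l"
          using survivor_end i I_n_end[of l] by simp
      next
        assume "start_time 0 l \<le> i \<and> i \<le> end_time 0 (Suc n) I l"
        then show "l \<in> I i"
          using i prev_end_le[OF True] by (cases "l \<in> I (Suc n)") (simp_all add: end_time_Suc)
      qed
    next
      case False
      then have "i \<le> n" using i by simp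
      show ?thesis
      proof (cases "l \<in> I n")
        case l: True
        show ?thesis
          using prev_iff[OF True, of i] I_n_end[OF l] \<open>i \<le> n\<close> by (simp add: end_time_Suc)
      next
        case l: False
        then have "l \<in> (\<Union>i\<in>{0..n}. I i) - I n" using True by blast
        from end_time_past[OF this] show ?thesis
          using prev_iff[OF True, of i] \<open>i \<le> n\<close> by simp
      qed
    qed
  next
    case False
    then have "l \<in> births \<MM> (Suc n) \<inter> I (Suc n)"
      using l unfolding union_Suc by auto
    moreover have "l \<notin> I i" if "i \<le> n" using False that by auto
    ultimately show ?thesis
      using i fst_births[of l] end_time_birth[of l] by (cases "i = Suc n") auto
  qed
qed

private lemma finite_I: "i \<le> Suc n \<Longrightarrow> finite (I i)"
  using I by (auto simp: label_seqs_def Fpow_def PiE_iff)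

text \<open>On each of the first three classes the end time is constant, and on the last it is
  unchanged from the prefix. The classes are disjoint because a label born at \<open>Suc n\<close>
  cannot occur earlier.\<close>

lemma prod_trajectories_Suc:
  fixes f :: "nat \<Rightarrow> 'a label \<Rightarrow> 'b::comm_monoid_mult"
  shows "(\<Prod>l\<in>(\<Union>i\<in>{0..Suc n}. I i). f (end_time 0 (Suc n) I l) l) =
    (\<Prod>l\<in>births \<MM> (Suc n) \<inter> I (Suc n). f (Suc n) l) * (\<Prod>l\<in>I n \<inter> I (Suc n). f (Suc n) l) *
    (\<Prod>l\<in>I n - I (Suc n). f n l) *
    (\<Prod>l\<in>(\<Union>i\<in>{0..n}. I i) - I n. f (end_time 0 n (restrict I {0..n}) l) l)"
proof -
  have new: "l \<notin> I i" if "l \<in> births \<MM> (Suc n)" "i \<le> n" for l i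
    using fst_births[OF that(1)] fst_le[of i l] that(2) by auto
  have "(\<Prod>l\<in>(\<Union>i\<in>{0..Suc n}. I i). f (end_time 0 (Suc n) I l) l) =
    (\<Prod>l\<in>births \<MM> (Suc n) \<inter> I (Suc n). f (end_time 0 (Suc n) I l) l) *
    (\<Prod>l\<in>I n \<inter> I (Suc n). f (end_time 0 (Suc n) I l) l) *
    (\<Prod>l\<in>I n - I (Suc n). f (end_time 0 (Suc n) I l) l) *
    (\<Prod>l\<in>(\<Union>i\<in>{0..n}. I i) - I n. f (end_time 0 (Suc n) I l) l)"
    unfolding union_Suc using new
    by (subst prod.union_disjoint; (auto simp: finite_I)?)+
  then show ?thesis
    using end_time_birth survivor_end dead_end end_time_past by simp
qed

text \<open>The companion decomposition of the prefix. Up to time \<open>n\<close>, survivors and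
  dying labels both end at \<open>n\<close>; splitting them anyway lets the two products be compared
  class by class.\<close>

lemma prod_trajectories_prev:
  fixes f :: "nat \<Rightarrow> 'a label \<Rightarrow> 'b::comm_monoid_mult"
  shows "(\<Prod>l\<in>(\<Union>i\<in>{0..n}. I i). f (end_time 0 n (restrict I {0..n}) l) l) =
    (\<Prod>l\<in>I n \<inter> I (Suc n). f n l) * (\<Prod>l\<in>I n - I (Suc n). f n l) *
    (\<Prod>l\<in>(\<Union>i\<in>{0..n}. I i) - I n. f (end_time 0 n (restrict I {0..n}) l) l)"
proof -
  let ?f = "\<lambda>l. f (end_time 0 n (restrict I {0..n}) l) l"
  have U: "(\<Union>i\<in>{0..n}. I i) = (I n \<inter> I (Suc n)) \<union> (I n - I (Suc n)) \<union> ((\<Union>i\<in>{0..n}. I i) - I n)"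
    by auto
  have "prod ?f (\<Union>i\<in>{0..n}. I i) = prod ?f (I n \<inter> I (Suc n)) * prod ?f (I n - I (Suc n)) *
      prod ?f ((\<Union>i\<in>{0..n}. I i) - I n)"
    by (subst U, (subst prod.union_disjoint; (auto simp: finite_I)?)+)
  then show ?thesis
    using I_n_end by simp
qed

text \<open>The point where two case distinctions meet: \<open>step_den\<close> looks at start and
  end times, \<open>step_weight\<close> at membership in \<open>dom \<theta>\<close> and in the
  births. They agree because \<open>dom \<theta>\<close> is the label set at \<open>Suc n\<close>,
  so being in the domain means being alive at the new time.\<close>

lemma step_den_eq_step_weight:
  assumes "dom \<theta> = I (Suc n)" "l \<in> (\<Union>i\<in>{0..Suc n}. I i)"
  shows "step_den \<MM> (Suc n) z h \<theta> (end_time 0 (Suc n) I l) l =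
    (if l \<in> (births \<MM> (Suc n) \<inter> I (Suc n)) \<union> I n then step_weight \<MM> (Suc n) z h \<theta> l else 1)"
proof -
  have new: "l \<notin> births \<MM> (Suc n)" if "l \<in> I i" "i \<le> n" for i
    using fst_births[of l] fst_le[of i l] that by auto
  from assms(2)[unfolded union_Suc]
  consider "l \<in> births \<MM> (Suc n) \<inter> I (Suc n)" | "l \<in> I n \<inter> I (Suc n)" | "l \<in> I n - I (Suc n)"
    | "l \<in> (\<Union>i\<in>{0..n}. I i) - I n" by blast
  then show ?thesis
  proof cases
    case 1
    then show ?thesis
      using assms(1) fst_births[of l] by (simp add: step_den_def step_weight_def)
  next
    case 2
    then show ?thesis
      using assms(1) survivor_end[OF 2] new[of n] I_n_end[of l] by (simp add: step_den_def step_weight_def)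
  next
    case 3
    then show ?thesis
      using assms(1) dead_end[OF 3] new[of n] I_n_end[of l] by (simp add: step_den_def step_weight_def)
  next
    case 4
    then have "l \<notin> births \<MM> (Suc n)" "l \<notin> I n"
      using new by auto
    then show ?thesis
      using end_time_past[OF 4] by (simp add: step_den_def)
  qed
qed

text \<open>Potential births that did not happen have no trajectory and contribute the separate
  factor \<open>QB\<close>; trajectories gone before \<open>n\<close> have denominator 1 and may be
  added to the product freely.\<close>

lemma prod_step_weight:
  assumes dom: "dom \<theta> = I (Suc n)"
  shows "(\<Prod>l\<in>births \<MM> (Suc n) \<union> I n. step_weight \<MM> (Suc n) z h \<theta> l) =
    (\<Prod>l\<in>births \<MM> (Suc n) - I (Suc n). QB \<MM> (Suc n) l) *
    (\<Prod>l\<in>(\<Union>i\<in>{0..Suc n}. I i). step_den \<MM> (Suc n) z h \<theta> (end_time 0 (Suc n) I l) l)"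
proof -
  let ?B = "births \<MM> (Suc n)" and ?U = "\<Union>i\<in>{0..Suc n}. I i"
  have fin: "finite ?B" by (rule finite_births[OF model])
  have new: "l \<notin> ?B" if "l \<in> I n" for l
    using fst_births[of l] I_n_end[OF that] by auto
  have finU: "finite ?U" by (simp add: finite_I)
  have S: "(?B \<inter> I (Suc n)) \<union> I n \<subseteq> ?U" by (auto simp: atLeastAtMostSuc_conv)
  have "?B \<union> I n = (?B - I (Suc n)) \<union> ((?B \<inter> I (Suc n)) \<union> I n)" by auto
  then have "(\<Prod>l\<in>?B \<union> I n. step_weight \<MM> (Suc n) z h \<theta> l) =
      (\<Prod>l\<in>?B - I (Suc n). step_weight \<MM> (Suc n) z h \<theta> l) *
      (\<Prod>l\<in>(?B \<inter> I (Suc n)) \<union> I n. step_weight \<MM> (Suc n) z h \<theta> l)"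
    using fin finite_I[of n] new by (simp only:) (subst prod.union_disjoint, auto)
  also have "(\<Prod>l\<in>?B - I (Suc n). step_weight \<MM> (Suc n) z h \<theta> l) = (\<Prod>l\<in>?B - I (Suc n). QB \<MM> (Suc n) l)"
    using dom by (intro prod.cong) (auto simp: step_weight_def)
  also have "(\<Prod>l\<in>(?B \<inter> I (Suc n)) \<union> I n. step_weight \<MM> (Suc n) z h \<theta> l) =
      (\<Prod>l\<in>?U. if l \<in> (?B \<inter> I (Suc n)) \<union> I n then step_weight \<MM> (Suc n) z h \<theta> l else 1)"
    using finU S by (intro prod.mono_neutral_cong_left) auto
  also have "\<dots> = (\<Prod>l\<in>?U. step_den \<MM> (Suc n) z h \<theta> (end_time 0 (Suc n) I l) l)"
    by (intro prod.cong refl step_den_eq_step_weight[OF dom, symmetric])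
  finally show ?thesis .
qed

end

subsection \<open>The terms of the unnormalised posterior\<close>

text \<open>The delta on \<open>L(X_k)\<close> is absorbed into the weight, because
  \<open>multiscan_glmb\<close> expects a weight that depends on the whole label sequence.\<close>

definition posterior_weight ::
    "('x, 'a, 'z) mo_system \<Rightarrow> nat \<Rightarrow> (nat \<Rightarrow> 'z) \<Rightarrow> ('c \<Rightarrow> (nat \<Rightarrow> 'a label set) \<Rightarrow> ennreal) \<Rightarrow>
     ('c \<Rightarrow> ('x, 'a) traj_fun) \<Rightarrow> 'c \<times> ('a label \<Rightarrow> nat option) \<Rightarrow> (nat \<Rightarrow> 'a label set) \<Rightarrow> ennreal" where
  "posterior_weight \<MM> k z w p c I =
     update_weight \<MM> k z w p c (restrict I {0..k - 1}) * of_bool (I k = dom (snd c))"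

text \<open>Contains no division, so its relation to the unnormalised posterior holds pointwise even
  where denominators degenerate.\<close>

definition posterior_term ::
    "('x, 'a, 'z) mo_system \<Rightarrow> nat \<Rightarrow> (nat \<Rightarrow> 'z) \<Rightarrow> ('c \<Rightarrow> (nat \<Rightarrow> 'a label set) \<Rightarrow> ennreal) \<Rightarrow>
     ('c \<Rightarrow> ('x, 'a) traj_fun) \<Rightarrow> 'c \<times> ('a label \<Rightarrow> nat option) \<Rightarrow>
     (nat \<Rightarrow> ('x, 'a) mstate) \<Rightarrow> ennreal" where
  "posterior_term \<MM> k z w p c X =
     w (fst c) (labels_seq 0 (k - 1) X) *
     of_bool (dom (snd c) \<subseteq> births \<MM> k \<union> labels (X (k - 1)) \<and> labels (X k) = dom (snd c)) *
     (\<Prod>l\<in>births \<MM> k - labels (X k). QB \<MM> k l) *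
     multiscan_exp 0 k (step_num \<MM> k z (p (fst c)) (snd c)) X"

lemma mult_normalised: "d \<noteq> 0 \<Longrightarrow> d \<noteq> \<infinity> \<Longrightarrow> d * normalised r a d = a"
  by (simp add: normalised_def ennreal_times_divide mult.commute[of d] mult_divide_eq_ennreal)

lemma labels_seq_in_label_seqs: "X \<in> mstate_seqs \<MM> j k \<Longrightarrow> labels_seq j k X \<in> label_seqs \<MM> j k"
  by (force simp: mstate_seqs_def label_seqs_def labels_seq_def labels_def mstates_def Fpow_def PiE_iff)

lemma labels_seq_prefix: "n \<le> k \<Longrightarrow> labels_seq j n X = restrict (labels_seq j k X) {j..n}"
  by (auto simp: labels_seq_def fun_eq_iff)

lemma inj_on_snd_distinct:
  assumes "distinct_ind Y = 1" "finite Y"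
  shows "inj_on snd Y"
  using assms by (auto simp: distinct_ind_def labels_def intro!: eq_card_imp_inj_on)

text \<open>Distinct labels make \<open>snd\<close> injective on the state. This reconciles the
  likelihood, a product over points, with the transition density, a product over labels.\<close>

lemma prod_labels_state_of:
  assumes "distinct_ind Y = 1" "finite Y"
  shows "(\<Prod>(x, l)\<in>Y. f x l) = (\<Prod>l\<in>labels Y. f (state_of Y l) l)"
proof -
  have inj: "inj_on snd Y" by (rule inj_on_snd_distinct[OF assms])
  have "state_of Y l = x" if "(x, l) \<in> Y" for x l
    unfolding state_of_def
  proof (rule the_equality)
    show "(x, l) \<in> Y" by (rule that)
  next
    fix x' assume "(x', l) \<in> Y"
    with inj_onD[OF inj, of "(x', l)" "(x, l)"] that show "x' = x" by simp
  qed
  then have "(\<Prod>(x, l)\<in>Y. f x l) = (\<Prod>y\<in>Y. f (state_of Y (snd y)) (snd y))"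
    by (intro prod.cong) auto
  also have "\<dots> = (\<Prod>l\<in>labels Y. f (state_of Y l) l)"
    unfolding labels_def by (simp add: prod.reindex[OF inj])
  finally show ?thesis .
qed

lemma multiscan_exp_eq_prod:
  "multiscan_exp 0 k h X = (\<Prod>l\<in>(\<Union>i\<in>{0..k}. labels_seq 0 k X i).
     h (end_time 0 k (labels_seq 0 k X) l)
       (\<lambda>i\<in>{fst l..end_time 0 k (labels_seq 0 k X) l}. state_of (X i) l) l)"
  by (simp add: multiscan_exp_def Let_def labels_seq_def)

context
  fixes \<MM> :: "('x, 'a, 'z) mo_system" and n :: nat and X :: "nat \<Rightarrow> ('x, 'a) mstate"
    and \<theta> :: "'a label \<Rightarrow> nat option"
  assumes model: "mo_system_model \<MM>"
    and X: "X \<in> mstate_seqs \<MM> 0 (Suc n)"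
    and prev: "trajectory_labels 0 n (labels_seq 0 n X)"
    and dom: "labels (X (Suc n)) = dom \<theta>"
    and sub: "dom \<theta> \<subseteq> births \<MM> (Suc n) \<union> labels (X n)"
begin

private abbreviation (input) "II \<equiv> labels_seq 0 (Suc n) X"

private lemma II: "II \<in> label_seqs \<MM> 0 (Suc n)"
  by (rule labels_seq_in_label_seqs[OF X])

private lemma II_prev: "trajectory_labels 0 n (restrict II {0..n})"
  using prev labels_seq_prefix[of n "Suc n" 0 X] by simp

private lemma II_nth: "i \<le> Suc n \<Longrightarrow> II i = labels (X i)"
  by (simp add: labels_seq_def)

private lemma II_sub: "II (Suc n) \<subseteq> births \<MM> (Suc n) \<union> II n"
  using sub dom by (simp add: labels_seq_def)

text \<open>The Bayes update for one component, factor by factor. Newborns and survivors together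
  make up the labels at \<open>Suc n\<close>, disjointly, so the likelihood splits over these two
  classes; survival, death and birth factors then attach to their own classes, finished trajectories
  keep their density, and only the \<open>QB\<close> factors belong to no trajectory.\<close>

lemma likelihood_transition_eq_step_num:
  assumes distinct: "distinct_ind (X (Suc n)) = 1"
  shows "(\<Prod>(x, l)\<in>X (Suc n). psi \<MM> (Suc n) z (the (\<theta> l)) x l) *
      transition_density \<MM> (Suc n) (X (Suc n)) (X n) * multiscan_exp 0 n h (restrict X {0..n}) =
    (\<Prod>l\<in>births \<MM> (Suc n) - labels (X (Suc n)). QB \<MM> (Suc n) l) *
      multiscan_exp 0 (Suc n) (step_num \<MM> (Suc n) z h \<theta>) X"
proof -
  let ?Y = "X (Suc n)" and ?B = "births \<MM> (Suc n)"
  let ?L = "labels (X (Suc n))" and ?L' = "labels (X n)"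
  have finY: "finite ?Y"
    using X by (auto simp: mstate_seqs_def mstates_def Fpow_def PiE_iff)
  have finL: "finite ?L" using finY by (simp add: labels_def)
  have new: "l \<notin> ?L'" if "l \<in> ?B" for l
  proof
    assume "l \<in> ?L'"
    then have "l \<in> label_space \<MM> n"
      using X by (force simp: mstate_seqs_def mstates_def Fpow_def PiE_iff labels_def)
    then show False using births_fst[OF model that] by (simp add: label_space_iff[OF model])
  qed
  define H where "H t l = h t (\<lambda>i\<in>{fst l..t}. state_of (X i) l) l" for t l
  define F where "F t l = step_num \<MM> (Suc n) z h \<theta> t (\<lambda>i\<in>{fst l..t}. state_of (X i) l) l" for t l
  let ?R = "\<Prod>l\<in>(\<Union>i\<in>{0..n}. II i) - II n. H (end_time 0 n (restrict II {0..n}) l) l"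
  let ?psi = "\<lambda>l. psi \<MM> (Suc n) z (the (\<theta> l)) (state_of ?Y l) l"
  have "multiscan_exp 0 n h (restrict X {0..n})
      = (\<Prod>l\<in>(\<Union>i\<in>{0..n}. II i). H (end_time 0 n (restrict II {0..n}) l) l)"
  proof -
    have eq: "labels_seq 0 n (restrict X {0..n}) = restrict II {0..n}"
      by (auto simp: labels_seq_def fun_eq_iff)
    show ?thesis
      unfolding multiscan_exp_eq_prod eq H_def
    proof (rule prod.cong)
      fix l assume "l \<in> (\<Union>i\<in>{0..n}. II i)"
      \<comment> \<open>On the times of a prefix trajectory, \<open>restrict X {0..n}\<close> agrees
        with \<open>X\<close>, so the prior densities see the same states.\<close>
      then have "i \<le> n" if "i \<in> {fst l..end_time 0 n (restrict II {0..n}) l}" for i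
        using trajectory_labels_iff[OF II_prev, of l i] that by auto
      then show "h (end_time 0 n (restrict II {0..n}) l)
          (\<lambda>i\<in>{fst l..end_time 0 n (restrict II {0..n}) l}. state_of (restrict X {0..n} i) l) l =
        h (end_time 0 n (restrict II {0..n}) l)
          (\<lambda>i\<in>{fst l..end_time 0 n (restrict II {0..n}) l}. state_of (X i) l) l"
        by (intro arg_cong2[where f = "h _"] refl restrict_ext) simp
    qed auto
  qed
  also have "\<dots> = (\<Prod>l\<in>?L' \<inter> ?L. H n l) * (\<Prod>l\<in>?L' - ?L. H n l) * ?R"
    by (subst prod_trajectories_prev[OF model II II_prev II_sub]) (simp add: II_nth)
  finally have prev: "multiscan_exp 0 n h (restrict X {0..n})
      = (\<Prod>l\<in>?L' \<inter> ?L. H n l) * (\<Prod>l\<in>?L' - ?L. H n l) * ?R" .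
  have past: "F (end_time 0 n (restrict II {0..n}) l) l = H (end_time 0 n (restrict II {0..n}) l) l"
    if "l \<in> (\<Union>i\<in>{0..n}. II i) - II n" for l
    using end_time_past[OF model II II_prev II_sub that] by (simp add: F_def H_def step_num_def)
  have "multiscan_exp 0 (Suc n) (step_num \<MM> (Suc n) z h \<theta>) X =
      (\<Prod>l\<in>?B \<inter> ?L. F (Suc n) l) * (\<Prod>l\<in>?L' \<inter> ?L. F (Suc n) l) * (\<Prod>l\<in>?L' - ?L. F n l) * ?R"
    unfolding multiscan_exp_eq_prod F_def[symmetric]
    by (subst prod_trajectories_Suc[OF model II II_prev II_sub]) (simp add: II_nth past)
  moreover have "(\<Prod>l\<in>?B \<inter> ?L. F (Suc n) l)
      = (\<Prod>l\<in>?B \<inter> ?L. ?psi l) * (\<Prod>l\<in>?B \<inter> ?L. PB \<MM> (Suc n) l * fB \<MM> (Suc n) (state_of ?Y l) l)"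
    unfolding prod.distrib[symmetric]
  proof (intro prod.cong refl)
    fix l assume "l \<in> ?B \<inter> ?L"
    then have "fst l = Suc n" using births_fst[OF model] by auto
    then show "F (Suc n) l = ?psi l * (PB \<MM> (Suc n) l * fB \<MM> (Suc n) (state_of ?Y l) l)"
      by (simp add: F_def step_num_def Lambda_B_def mult_ac)
  qed
  moreover have fst: "fst l \<le> n" if "l \<in> ?L'" for l
  proof -
    have "l \<in> label_space \<MM> n"
      using X that by (force simp: mstate_seqs_def mstates_def Fpow_def PiE_iff labels_def)
    then show ?thesis by (simp add: label_space_iff[OF model])
  qed
  \<comment> \<open>Cutting a survivor's path back to time \<open>n\<close> gives the path at which
    the prior density is evaluated; for a dying label the cut changes nothing.\<close>
  have res: "restrict (\<lambda>i\<in>{fst l..t}. state_of (X i) l) {fst l..n} = (\<lambda>i\<in>{fst l..n}. state_of (X i) l)"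
    if "n \<le> t" for l t
    using that by (auto simp: fun_eq_iff)
  have "(\<Prod>l\<in>?L' \<inter> ?L. F (Suc n) l) = (\<Prod>l\<in>?L' \<inter> ?L. ?psi l) *
      (\<Prod>l\<in>?L' \<inter> ?L. PS \<MM> n (state_of (X n) l) l * fS \<MM> (Suc n) (state_of ?Y l) (state_of (X n) l) l) *
      (\<Prod>l\<in>?L' \<inter> ?L. H n l)"
    unfolding prod.distrib[symmetric]
  proof (intro prod.cong refl)
    fix l assume "l \<in> ?L' \<inter> ?L"
    then have "fst l \<le> n" using fst by auto
    then show "F (Suc n) l = ?psi l *
        (PS \<MM> n (state_of (X n) l) l * fS \<MM> (Suc n) (state_of ?Y l) (state_of (X n) l) l) * H n l"
      by (simp add: F_def H_def step_num_def Lambda_S_def res mult_ac)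
  qed
  moreover have "(\<Prod>l\<in>?L' - ?L. F n l)
      = (\<Prod>l\<in>?L' - ?L. QS \<MM> n (state_of (X n) l) l) * (\<Prod>l\<in>?L' - ?L. H n l)"
    unfolding prod.distrib[symmetric]
  proof (intro prod.cong refl)
    fix l assume "l \<in> ?L' - ?L"
    then have "fst l \<le> n" using fst by auto
    then show "F n l = QS \<MM> n (state_of (X n) l) l * H n l"
      by (simp add: F_def H_def step_num_def res)
  qed
  moreover have "(\<Prod>(x, l)\<in>?Y. psi \<MM> (Suc n) z (the (\<theta> l)) x l)
      = (\<Prod>l\<in>?B \<inter> ?L. ?psi l) * (\<Prod>l\<in>?L' \<inter> ?L. ?psi l)"
  proof -
    have L: "?L = (?B \<inter> ?L) \<union> (?L' \<inter> ?L)" using sub dom by auto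
    have "(\<Prod>l\<in>?L. ?psi l) = (\<Prod>l\<in>?B \<inter> ?L. ?psi l) * (\<Prod>l\<in>?L' \<inter> ?L. ?psi l)"
      by (subst L, rule prod.union_disjoint) (use finL new in auto)
    then show ?thesis
      using prod_labels_state_of[OF distinct finY, of "\<lambda>x l. psi \<MM> (Suc n) z (the (\<theta> l)) x l"]
      by simp
  qed
  moreover have "?L \<in> Fpow (?B \<union> ?L')"
    using sub dom finL by (simp add: Fpow_def)
  then have "transition_density \<MM> (Suc n) ?Y (X n) =
     (\<Prod>l\<in>?B - ?L. QB \<MM> (Suc n) l) * (\<Prod>l\<in>?L' - ?L. QS \<MM> n (state_of (X n) l) l) *
     (\<Prod>l\<in>?B \<inter> ?L. PB \<MM> (Suc n) l * fB \<MM> (Suc n) (state_of ?Y l) l) *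
     (\<Prod>l\<in>?L' \<inter> ?L. PS \<MM> n (state_of (X n) l) l * fS \<MM> (Suc n) (state_of ?Y l) (state_of (X n) l) l)"
    using distinct by (simp add: transition_density_def)
  ultimately show ?thesis
    unfolding prev by (simp only: mult_ac)
qed

text \<open>Missed births are left out of \<open>nz\<close>: their \<open>QB\<close> factors appear
  on both sides and are never divided by, so they may be 0.\<close>

lemma step_num_eq_step_weight_update_density:
  assumes nz: "\<And>l. l \<in> (births \<MM> (Suc n) \<inter> dom \<theta>) \<union> labels (X n) \<Longrightarrow>
      0 < step_weight \<MM> (Suc n) z (p \<xi>) \<theta> l \<and> step_weight \<MM> (Suc n) z (p \<xi>) \<theta> l < \<infinity>"
  shows "(\<Prod>l\<in>births \<MM> (Suc n) - labels (X (Suc n)). QB \<MM> (Suc n) l) *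
      multiscan_exp 0 (Suc n) (step_num \<MM> (Suc n) z (p \<xi>) \<theta>) X =
    (\<Prod>l\<in>births \<MM> (Suc n) \<union> labels (X n). step_weight \<MM> (Suc n) z (p \<xi>) \<theta> l) *
      multiscan_exp 0 (Suc n) (update_density \<MM> (Suc n) z r p (\<xi>, \<theta>)) X"
proof -
  let ?U = "\<Union>i\<in>{0..Suc n}. II i" and ?t = "\<lambda>l. end_time 0 (Suc n) II l"
  let ?d = "\<lambda>l. step_den \<MM> (Suc n) z (p \<xi>) \<theta> (?t l) l"
  have domII: "dom \<theta> = II (Suc n)" using dom by (simp add: II_nth)
  have d: "?d l \<noteq> 0 \<and> ?d l \<noteq> \<infinity>" if "l \<in> ?U" for l
    using step_den_eq_step_weight[OF model II II_prev II_sub domII that, of z "p \<xi>"] nz[of l] domII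
    by (auto simp: II_nth)
  have "multiscan_exp 0 (Suc n) (step_num \<MM> (Suc n) z (p \<xi>) \<theta>) X = (\<Prod>l\<in>?U. ?d l *
      update_density \<MM> (Suc n) z r p (\<xi>, \<theta>) (?t l) (\<lambda>i\<in>{fst l..?t l}. state_of (X i) l) l)"
    unfolding multiscan_exp_eq_prod
  proof (rule prod.cong)
    fix l assume "l \<in> ?U"
    from d[OF this] show "step_num \<MM> (Suc n) z (p \<xi>) \<theta> (?t l) (\<lambda>i\<in>{fst l..?t l}. state_of (X i) l) l
      = ?d l * update_density \<MM> (Suc n) z r p (\<xi>, \<theta>) (?t l) (\<lambda>i\<in>{fst l..?t l}. state_of (X i) l) l"
      by (simp add: update_density_eq_normalised mult_normalised)
  qed simp
  then show ?thesis
    using prod_step_weight[OF model II II_prev II_sub domII, of z "p \<xi>"]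
    by (simp add: prod.distrib multiscan_exp_eq_prod II_nth mult.assoc)
qed

end

subsection \<open>Integrals of the terms and the posterior\<close>

lemma finite_label_space: "mo_system_model \<MM> \<Longrightarrow> finite (label_space \<MM> k)"
  by (simp add: label_space_def finite_births)

lemma finite_assoc_maps:
  assumes "mo_system_model \<MM>"
  shows "finite (assoc_maps \<MM> k Z)"
proof (rule finite_subset)
  show "assoc_maps \<MM> k Z \<subseteq>
      (\<Union>D\<in>Pow (label_space \<MM> k). {\<theta>. dom \<theta> = D \<and> ran \<theta> \<subseteq> {0..card Z}})"
    by (auto simp: assoc_maps_def)
  show "finite (\<Union>D\<in>Pow (label_space \<MM> k). {\<theta>. dom \<theta> = D \<and> ran \<theta> \<subseteq> {0..card Z}})"
    using finite_label_space[OF assms, of k]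
    by (auto intro!: finite_set_of_finite_maps dest: finite_subset)
qed

lemma mstate_seqs_restrict:
  "X \<in> mstate_seqs \<MM> j k \<Longrightarrow> n \<le> k \<Longrightarrow> restrict X {j..n} \<in> mstate_seqs \<MM> j n"
  by (auto simp: mstate_seqs_def PiE_iff)

lemma labels_seq_restrict [simp]: "labels_seq j n (restrict X {j..n}) = labels_seq j n X"
  by (auto simp: labels_seq_def fun_eq_iff)

lemma distinct_ind_seq_restrict [simp]: "distinct_ind_seq j n (restrict X {j..n}) = distinct_ind_seq j n X"
  by (auto simp: distinct_ind_seq_def intro: prod.cong)

lemma distinct_ind_seq_Suc:
  "distinct_ind_seq 0 (Suc n) X = distinct_ind_seq 0 n X * distinct_ind (X (Suc n))"
  by (simp add: distinct_ind_seq_def atLeastAtMostSuc_conv mult.commute)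

lemma posterior_weight_eq_0:
  assumes "w \<xi> (restrict I {0..n}) = 0 \<or> \<not> dom \<theta> \<subseteq> births \<MM> (Suc n) \<union> I n \<or> I (Suc n) \<noteq> dom \<theta>"
  shows "posterior_weight \<MM> (Suc n) z w p (\<xi>, \<theta>) I = 0"
  using assms by (auto simp: posterior_weight_def update_weight_def Fpow_def indicator_def)

lemma posterior_weight_eq_prod:
  assumes "dom \<theta> \<subseteq> births \<MM> (Suc n) \<union> I n" "I (Suc n) = dom \<theta>" "finite (I (Suc n))"
  shows "posterior_weight \<MM> (Suc n) z w p (\<xi>, \<theta>) I =
    (\<Prod>l\<in>births \<MM> (Suc n) \<union> I n. step_weight \<MM> (Suc n) z (p \<xi>) \<theta> l) * w \<xi> (restrict I {0..n})"
  using assms by (simp add: posterior_weight_def update_weight_def Fpow_def)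

context
  fixes \<MM> :: "('x, 'a, 'z) mo_system" and n :: nat and z :: "nat \<Rightarrow> 'z"
    and \<Xi> :: "'c set" and w :: "'c \<Rightarrow> (nat \<Rightarrow> 'a label set) \<Rightarrow> ennreal"
    and p :: "'c \<Rightarrow> ('x, 'a) traj_fun"
  assumes model: "mo_system_model \<MM>"
    and params: "multiscan_glmb_params \<MM> 0 n \<Xi> w p"
begin

private lemma weight_0:
  "\<xi> \<in> \<Xi> \<Longrightarrow> I \<in> label_seqs \<MM> 0 n \<Longrightarrow> \<not> trajectory_labels 0 n I \<Longrightarrow> w \<xi> I = 0"
  using params by (simp add: multiscan_glmb_params_def)

private lemma densities: "\<xi> \<in> \<Xi> \<Longrightarrow> traj_densities \<MM> 0 n (p \<xi>)"
  using params by (simp add: multiscan_glmb_params_def)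

private lemma weight_labels_seq_0:
  assumes "\<xi> \<in> \<Xi>" "X \<in> mstate_seqs \<MM> 0 (Suc n)" "\<not> trajectory_labels 0 n (labels_seq 0 n X)"
  shows "w \<xi> (labels_seq 0 n X) = 0"
proof -
  have "labels_seq 0 n X \<in> label_seqs \<MM> 0 n"
    using labels_seq_in_label_seqs[OF mstate_seqs_restrict[OF assms(2), of n]] by simp
  then show ?thesis using weight_0 assms by blast
qed

text \<open>Holds term by term. If the label set is not the domain of \<theta>, the prior weight is
  0, or an inadmissible label appears, then both sides vanish through the indicator, the weight or
  the transition density; a prefix with gaps falls under weight 0. What remains is the
  single-component update.\<close>

lemma unnorm_posterior_eq_sum:
  assumes X: "X \<in> mstate_seqs \<MM> 0 (Suc n)" and distinct: "distinct_ind_seq 0 (Suc n) X = 1"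
    and g: "\<forall>Y\<in>mstates \<MM> (Suc n). distinct_ind Y = 1 \<longrightarrow> g Y = c * likelihood_sum \<MM> (Suc n) Z z Y"
    and prior: "\<forall>X\<in>mstate_seqs \<MM> 0 n. \<pi> X = multiscan_glmb 0 n \<Xi> w p X"
  shows "unnorm_posterior \<MM> (Suc n) g \<pi> X =
    c * (\<Sum>\<^sub>\<infinity>d\<in>\<Xi> \<times> assoc_maps \<MM> (Suc n) Z. posterior_term \<MM> (Suc n) z w p d X)"
proof -
  let ?k = "Suc n" and ?Y = "X (Suc n)" and ?\<Theta> = "assoc_maps \<MM> (Suc n) Z"
  let ?tr = "transition_density \<MM> ?k ?Y (X n)" and ?X = "restrict X {0..n}"
  let ?ind = "\<lambda>\<theta>. indicator (assoc_maps_on \<MM> ?k Z (labels ?Y)) \<theta> :: ennreal"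
  let ?psi = "\<lambda>\<theta>. \<Prod>(x, l)\<in>?Y. psi \<MM> ?k z (the (\<theta> l)) x l"
  have Y: "?Y \<in> mstates \<MM> ?k" using X by (auto simp: mstate_seqs_def PiE_iff)
  have dY: "distinct_ind ?Y = 1"
    using distinct
    by (cases "card ?Y = card (labels ?Y)") (simp_all add: distinct_ind_seq_Suc distinct_ind_def)
  then have dX: "distinct_ind_seq 0 n X = 1"
    using distinct by (simp add: distinct_ind_seq_Suc)
  have "?ind \<theta> * ?psi \<theta> * ?tr * (w \<xi> (labels_seq 0 n X) * multiscan_exp 0 n (p \<xi>) ?X)
      = posterior_term \<MM> ?k z w p (\<xi>, \<theta>) X" if \<xi>: "\<xi> \<in> \<Xi>" and \<theta>: "\<theta> \<in> ?\<Theta>" for \<xi> \<theta>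
  proof -
    consider "labels ?Y \<noteq> dom \<theta>" | "w \<xi> (labels_seq 0 n X) = 0"
      | "labels ?Y = dom \<theta>" "\<not> labels ?Y \<subseteq> births \<MM> ?k \<union> labels (X n)"
      | "labels ?Y = dom \<theta>" "dom \<theta> \<subseteq> births \<MM> ?k \<union> labels (X n)"
        "trajectory_labels 0 n (labels_seq 0 n X)"
      using weight_labels_seq_0[OF \<xi> X] by fastforce
    then show ?thesis
    proof cases
      case 1
      then show ?thesis by (auto simp: assoc_maps_on_def posterior_term_def)
    next
      case 2
      then show ?thesis by (simp add: posterior_term_def)
    next
      case 3
      then show ?thesis by (auto simp: posterior_term_def transition_density_def Fpow_def)
    next
      case 4
      have "?psi \<theta> * ?tr * (w \<xi> (labels_seq 0 n X) * multiscan_exp 0 n (p \<xi>) ?X)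
          = w \<xi> (labels_seq 0 n X) * (?psi \<theta> * ?tr * multiscan_exp 0 n (p \<xi>) ?X)"
        by (simp only: mult_ac)
      also have "\<dots> = posterior_term \<MM> ?k z w p (\<xi>, \<theta>) X"
        unfolding likelihood_transition_eq_step_num[OF model X 4(3) 4(1) 4(2) dY]
        using 4 by (simp add: posterior_term_def mult.assoc)
      finally show ?thesis
        using 4(1) \<theta> by (simp add: assoc_maps_on_def)
    qed
  qed
  note summand = this
  have "unnorm_posterior \<MM> ?k g \<pi> X = c * (likelihood_sum \<MM> ?k Z z ?Y * ?tr *
      (\<Sum>\<^sub>\<infinity>\<xi>\<in>\<Xi>. w \<xi> (labels_seq 0 n X) * multiscan_exp 0 n (p \<xi>) ?X))"
    using g Y dY dX prior mstate_seqs_restrict[OF X, of n]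
    by (simp add: unnorm_posterior_def multiscan_glmb_def mult.assoc)
  also have "\<dots> = c * (\<Sum>\<^sub>\<infinity>\<xi>\<in>\<Xi>. \<Sum>\<theta>\<in>?\<Theta>. ?ind \<theta> * ?psi \<theta> * ?tr *
      (w \<xi> (labels_seq 0 n X) * multiscan_exp 0 n (p \<xi>) ?X))"
    by (simp only: infsum_cmult_right_ennreal[symmetric] likelihood_sum_def sum_distrib_right)
  also have "(\<Sum>\<^sub>\<infinity>\<xi>\<in>\<Xi>. \<Sum>\<theta>\<in>?\<Theta>. ?ind \<theta> * ?psi \<theta> * ?tr *
      (w \<xi> (labels_seq 0 n X) * multiscan_exp 0 n (p \<xi>) ?X))
    = (\<Sum>\<^sub>\<infinity>\<xi>\<in>\<Xi>. \<Sum>\<theta>\<in>?\<Theta>. posterior_term \<MM> ?k z w p (\<xi>, \<theta>) X)"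
    by (intro infsum_cong sum.cong refl summand)
  finally show ?thesis
    by (simp add: infsum_Times_finite_ennreal[OF finite_assoc_maps[OF model]])
qed

lemma posterior_term_integral:
  assumes I: "I \<in> label_seqs \<MM> 0 (Suc n)" and \<xi>: "\<xi> \<in> \<Xi>"
  shows measurable_posterior_term:
      "(\<lambda>x. posterior_term \<MM> (Suc n) z w p (\<xi>, \<theta>) (states_of_labels 0 (Suc n) I x))
        \<in> borel_measurable (\<Pi>\<^sub>M il\<in>Sigma {0..Suc n} I. refM \<MM>)" (is ?meas)
    and nn_integral_posterior_term:
      "(\<integral>\<^sup>+x. posterior_term \<MM> (Suc n) z w p (\<xi>, \<theta>) (states_of_labels 0 (Suc n) I x)
        \<partial>(\<Pi>\<^sub>M il\<in>Sigma {0..Suc n} I. refM \<MM>)) = posterior_weight \<MM> (Suc n) z w p (\<xi>, \<theta>) I" (is ?int)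
proof -
  let ?k = "Suc n" and ?I = "restrict I {0..n}" and ?B = "births \<MM> (Suc n)"
  let ?num = "step_num \<MM> ?k z (p \<xi>) \<theta>"
  have I': "?I \<in> label_seqs \<MM> 0 n" using label_seqs_restrict[OF I] by simp
  have fin: "finite (I ?k)" using I by (auto simp: label_seqs_def PiE_iff Fpow_def)
  \<comment> \<open>All factors that depend only on labels; the label sequence is fixed to
    \<open>I\<close> under the integral, so they are constant in \<open>x\<close>.\<close>
  define a where "a = w \<xi> ?I * of_bool (dom \<theta> \<subseteq> ?B \<union> I n \<and> I ?k = dom \<theta>) * (\<Prod>l\<in>?B - I ?k. QB \<MM> ?k l)"
  have eq: "posterior_term \<MM> ?k z w p (\<xi>, \<theta>) (states_of_labels 0 ?k I x)
      = a * multiscan_exp 0 ?k ?num (states_of_labels 0 ?k I x)" for x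
    using labels_seq_prefix[of n ?k 0 "states_of_labels 0 ?k I x"]
    by (simp add: a_def posterior_term_def labels_states_of_labels labels_seq_states_of_labels[OF I])
  show ?meas ?int
  proof (atomize (full), cases "trajectory_labels 0 n ?I \<and> dom \<theta> \<subseteq> ?B \<union> I n \<and> I ?k = dom \<theta>")
    case False
    then have "posterior_weight \<MM> ?k z w p (\<xi>, \<theta>) I = 0"
      using weight_0[OF \<xi> I'] by (intro posterior_weight_eq_0) blast
    moreover have "a = 0"
      using False weight_0[OF \<xi> I'] by (auto simp: a_def)
    ultimately show "?meas \<and> ?int" unfolding eq by simp
  next
    case True
    then have prev: "trajectory_labels 0 n ?I" and sub: "I ?k \<subseteq> ?B \<union> I n" and dom: "dom \<theta> = I ?k"
      by auto
    note traj = trajectory_labels_Suc[OF model I prev sub]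
    have num: "(\<lambda>x. ?num (end_time 0 ?k I l) x l)
          \<in> borel_measurable (\<Pi>\<^sub>M i\<in>{start_time 0 l..end_time 0 ?k I l}. refM \<MM>)"
        "(\<integral>\<^sup>+x. ?num (end_time 0 ?k I l) x l
          \<partial>(\<Pi>\<^sub>M i\<in>{start_time 0 l..end_time 0 ?k I l}. refM \<MM>))
          = step_den \<MM> ?k z (p \<xi>) \<theta> (end_time 0 ?k I l) l"
      if l: "l \<in> (\<Union>i\<in>{0..?k}. I i)" for l
    proof -
      from l obtain i where "i \<le> ?k" "l \<in> I i" by auto
      then have "l \<in> label_space \<MM> i" using I by (auto simp: label_seqs_def PiE_iff Fpow_def)
      then have L: "l \<in> label_space \<MM> ?k"
        using \<open>i \<le> ?k\<close> by (simp add: label_space_iff[OF model])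
      then have t: "fst l \<le> end_time 0 ?k I l" "end_time 0 ?k I l \<le> ?k"
        using start_time_le_end_time[of 0 l ?k I] end_time_le[of 0 l ?k I]
        by (simp_all add: label_space_iff[OF model])
      from step_num_density[OF model densities[OF \<xi>] L t, of z \<theta>]
      show "(\<lambda>x. ?num (end_time 0 ?k I l) x l)
          \<in> borel_measurable (\<Pi>\<^sub>M i\<in>{start_time 0 l..end_time 0 ?k I l}. refM \<MM>)"
        "(\<integral>\<^sup>+x. ?num (end_time 0 ?k I l) x l
          \<partial>(\<Pi>\<^sub>M i\<in>{start_time 0 l..end_time 0 ?k I l}. refM \<MM>))
          = step_den \<MM> ?k z (p \<xi>) \<theta> (end_time 0 ?k I l) l" by simp_all
    qed
    note meas [measurable] = measurable_multiscan_exp[OF sigma_finite_refM[OF model] I traj, where h = ?num, OF num(1)]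
    have "(\<integral>\<^sup>+x. a * multiscan_exp 0 ?k ?num (states_of_labels 0 ?k I x)
        \<partial>(\<Pi>\<^sub>M il\<in>Sigma {0..?k} I. refM \<MM>))
      = a * (\<Prod>l\<in>(\<Union>i\<in>{0..?k}. I i). step_den \<MM> ?k z (p \<xi>) \<theta> (end_time 0 ?k I l) l)"
      using nn_integral_multiscan_exp[OF sigma_finite_refM[OF model] I traj, where h = ?num, OF num(1)] num(2)
      by (simp add: nn_integral_cmult)
    also have "\<dots> = posterior_weight \<MM> ?k z w p (\<xi>, \<theta>) I"
      using prod_step_weight[OF model I prev sub dom, of z "p \<xi>"] sub dom fin
      by (simp add: a_def posterior_weight_eq_prod mult_ac)
    finally show "?meas \<and> ?int" unfolding eq by simp
  qed
qed

text \<open>The premises inside \<open>nz\<close> confine it to components that can contribute at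
  \<open>X\<close>; for all others the term and the weight are both 0. The identity is then
  pointwise.\<close>

lemma posterior_term_eq_weight:
  assumes X: "X \<in> mstate_seqs \<MM> 0 (Suc n)" and \<xi>: "\<xi> \<in> \<Xi>"
    and nz: "\<And>l. dom \<theta> = labels (X (Suc n)) \<Longrightarrow> dom \<theta> \<subseteq> births \<MM> (Suc n) \<union> labels (X n) \<Longrightarrow>
      l \<in> (births \<MM> (Suc n) \<inter> dom \<theta>) \<union> labels (X n) \<Longrightarrow>
      0 < step_weight \<MM> (Suc n) z (p \<xi>) \<theta> l \<and> step_weight \<MM> (Suc n) z (p \<xi>) \<theta> l < \<infinity>"
  shows "posterior_term \<MM> (Suc n) z w p (\<xi>, \<theta>) X =
    posterior_weight \<MM> (Suc n) z w p (\<xi>, \<theta>) (labels_seq 0 (Suc n) X) *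
    multiscan_exp 0 (Suc n) (update_density \<MM> (Suc n) z r p (\<xi>, \<theta>)) X"
proof -
  let ?k = "Suc n" and ?I = "labels_seq 0 (Suc n) X" and ?B = "births \<MM> (Suc n)"
  have I: "restrict ?I {0..n} = labels_seq 0 n X" "?I n = labels (X n)" "?I ?k = labels (X ?k)"
    by (auto simp: labels_seq_def fun_eq_iff)
  have fin: "finite (labels (X ?k))"
    using X by (auto simp: mstate_seqs_def mstates_def Fpow_def PiE_iff labels_def)
  show ?thesis
  proof (cases "trajectory_labels 0 n (labels_seq 0 n X) \<and> dom \<theta> \<subseteq> ?B \<union> labels (X n)
      \<and> labels (X ?k) = dom \<theta>")
    case False
    then have "posterior_weight \<MM> ?k z w p (\<xi>, \<theta>) ?I = 0"
      using weight_labels_seq_0[OF \<xi> X] unfolding I[symmetric] by (intro posterior_weight_eq_0) blast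
    moreover have "posterior_term \<MM> ?k z w p (\<xi>, \<theta>) X = 0"
      using False weight_labels_seq_0[OF \<xi> X] by (auto simp: posterior_term_def)
    ultimately show ?thesis by simp
  next
    case True
    then have a: "trajectory_labels 0 n (labels_seq 0 n X)" "labels (X ?k) = dom \<theta>"
      "dom \<theta> \<subseteq> ?B \<union> labels (X n)" by auto
    have "(\<Prod>l\<in>?B - labels (X ?k). QB \<MM> ?k l) * multiscan_exp 0 ?k (step_num \<MM> ?k z (p \<xi>) \<theta>) X
      = (\<Prod>l\<in>?B \<union> labels (X n). step_weight \<MM> ?k z (p \<xi>) \<theta> l) *
        multiscan_exp 0 ?k (update_density \<MM> ?k z r p (\<xi>, \<theta>)) X"
      using a nz by (intro step_num_eq_step_weight_update_density[OF model X]) auto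
    then show ?thesis
      using a fin I by (simp add: posterior_term_def posterior_weight_eq_prod mult_ac)
  qed
qed

text \<open>
  A component of weight 0 has integral 0 and hence vanishes almost everywhere, whatever its
  density; for the others no denominator is 0 or infinite.
\<close>

lemma AE_posterior_term_eq_weight:
  assumes I: "I \<in> label_seqs \<MM> 0 (Suc n)" and \<xi>: "\<xi> \<in> \<Xi>"
    and fin: "posterior_weight \<MM> (Suc n) z w p (\<xi>, \<theta>) I < \<infinity>"
  shows "AE x in (\<Pi>\<^sub>M il\<in>Sigma {0..Suc n} I. refM \<MM>).
    posterior_term \<MM> (Suc n) z w p (\<xi>, \<theta>) (states_of_labels 0 (Suc n) I x) =
    posterior_weight \<MM> (Suc n) z w p (\<xi>, \<theta>) I *
    multiscan_exp 0 (Suc n) (update_density \<MM> (Suc n) z r p (\<xi>, \<theta>)) (states_of_labels 0 (Suc n) I x)"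
proof (cases "posterior_weight \<MM> (Suc n) z w p (\<xi>, \<theta>) I = 0")
  case True
  with posterior_term_integral[OF I \<xi>, of \<theta>]
  have "AE x in (\<Pi>\<^sub>M il\<in>Sigma {0..Suc n} I. refM \<MM>).
      posterior_term \<MM> (Suc n) z w p (\<xi>, \<theta>) (states_of_labels 0 (Suc n) I x) = 0"
    by (simp add: nn_integral_0_iff_AE)
  then show ?thesis using True by simp
next
  case False
  let ?S = "births \<MM> (Suc n) \<union> I n" and ?sw = "step_weight \<MM> (Suc n) z (p \<xi>) \<theta>"
  have finS: "finite ?S"
    using I finite_births[OF model] by (auto simp: label_seqs_def PiE_iff Fpow_def)
  have nz: "prod ?sw ?S \<noteq> 0" "prod ?sw ?S \<noteq> \<infinity>"
    using False fin
    by (auto simp: posterior_weight_def update_weight_def ennreal_mult_eq_top_iff less_top[symmetric]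
        indicator_def split: if_splits)
  \<comment> \<open>Finiteness of a factor uses that the whole product is nonzero: an infinite
    factor could otherwise hide behind a zero one.\<close>
  have sw: "0 < ?sw l \<and> ?sw l < \<infinity>" if "l \<in> ?S" for l
  proof -
    have "prod ?sw ?S = ?sw l * prod ?sw (?S - {l})"
      using finS that by (rule prod.remove)
    then show ?thesis
      using nz by (auto simp: ennreal_mult_eq_top_iff less_top[symmetric] zero_less_iff_neq_zero)
  qed
  show ?thesis
  proof (rule AE_I2)
    fix x assume x: "x \<in> space (\<Pi>\<^sub>M il\<in>Sigma {0..Suc n} I. refM \<MM>)"
    have "posterior_term \<MM> (Suc n) z w p (\<xi>, \<theta>) (states_of_labels 0 (Suc n) I x) =
      posterior_weight \<MM> (Suc n) z w p (\<xi>, \<theta>)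
        (labels_seq 0 (Suc n) (states_of_labels 0 (Suc n) I x)) *
      multiscan_exp 0 (Suc n) (update_density \<MM> (Suc n) z r p (\<xi>, \<theta>)) (states_of_labels 0 (Suc n) I x)"
      using sw
      by (intro posterior_term_eq_weight[OF states_of_labels_in_mstate_seqs[OF I x] \<xi>])
        (auto simp: labels_states_of_labels)
    then
    show "posterior_term \<MM> (Suc n) z w p (\<xi>, \<theta>) (states_of_labels 0 (Suc n) I x) =
      posterior_weight \<MM> (Suc n) z w p (\<xi>, \<theta>) I *
      multiscan_exp 0 (Suc n) (update_density \<MM> (Suc n) z r p (\<xi>, \<theta>)) (states_of_labels 0 (Suc n) I x)"
      by (simp only: labels_seq_states_of_labels[OF I])
  qed
qed

lemma posterior_weight_trajectory:
  assumes I: "I \<in> label_seqs \<MM> 0 (Suc n)" and \<xi>: "\<xi> \<in> \<Xi>" and "\<not> trajectory_labels 0 (Suc n) I"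
  shows "posterior_weight \<MM> (Suc n) z w p (\<xi>, \<theta>) I = 0"
proof -
  let ?I = "restrict I {0..n}"
  have I': "?I \<in> label_seqs \<MM> 0 n" using label_seqs_restrict[OF I] by simp
  have "\<not> trajectory_labels 0 n ?I \<or> \<not> I (Suc n) \<subseteq> births \<MM> (Suc n) \<union> I n"
    using trajectory_labels_Suc[OF model I] assms(3) by blast
  then show ?thesis
    using weight_0[OF \<xi> I'] by (intro posterior_weight_eq_0) blast
qed

lemma countable_weights: "countable {\<xi>\<in>\<Xi>. \<exists>I\<in>label_seqs \<MM> 0 n. w \<xi> I \<noteq> 0}"
proof -
  have "countable {\<xi>\<in>\<Xi>. (\<Sum>I\<in>label_seqs \<MM> 0 n. w \<xi> I) \<noteq> 0}"
    using params by (intro countable_support_infsum_ennreal) (simp add: multiscan_glmb_params_def)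
  then show ?thesis
    by (simp add: sum_eq_0_iff[OF finite_label_seqs[OF model]])
qed

lemma posterior_term_weight_0:
  assumes "\<xi> \<in> \<Xi> - {\<xi>\<in>\<Xi>. \<exists>I\<in>label_seqs \<MM> 0 n. w \<xi> I \<noteq> 0}"
  shows "X \<in> mstate_seqs \<MM> 0 (Suc n) \<Longrightarrow> posterior_term \<MM> (Suc n) z w p (\<xi>, \<theta>) X = 0"
    and "I \<in> label_seqs \<MM> 0 (Suc n) \<Longrightarrow> posterior_weight \<MM> (Suc n) z w p (\<xi>, \<theta>) I = 0"
proof -
  have w: "w \<xi> I = 0" if "I \<in> label_seqs \<MM> 0 n" for I using assms that by blast
  show "posterior_term \<MM> (Suc n) z w p (\<xi>, \<theta>) X = 0" if "X \<in> mstate_seqs \<MM> 0 (Suc n)"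
    using w[OF labels_seq_in_label_seqs[OF mstate_seqs_restrict[OF that, of n]]]
    by (simp add: posterior_term_def)
  show "posterior_weight \<MM> (Suc n) z w p (\<xi>, \<theta>) I = 0" if "I \<in> label_seqs \<MM> 0 (Suc n)"
    using w[OF label_seqs_restrict[OF that, of n]]
    by (simp add: posterior_weight_def update_weight_def)
qed

text \<open>For each fixed label sequence the terms are integrated one by one, which is legitimate
  because they vanish identically outside the countable set of components with some nonzero prior
  weight. The sum over label sequences is finite and can be moved inside.\<close>

lemma norm_const_eq_sum:
  assumes g: "\<forall>Y\<in>mstates \<MM> (Suc n). distinct_ind Y = 1 \<longrightarrow> g Y = c * likelihood_sum \<MM> (Suc n) Z z Y"
    and prior: "\<forall>X\<in>mstate_seqs \<MM> 0 n. \<pi> X = multiscan_glmb 0 n \<Xi> w p X"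
  shows "norm_const \<MM> (Suc n) g \<pi> = c * (\<Sum>\<^sub>\<infinity>d\<in>\<Xi> \<times> assoc_maps \<MM> (Suc n) Z.
    \<Sum>I\<in>label_seqs \<MM> 0 (Suc n). posterior_weight \<MM> (Suc n) z w p d I)"
proof -
  let ?k = "Suc n" and ?\<Theta> = "assoc_maps \<MM> (Suc n) Z"
  let ?S = "{\<xi>\<in>\<Xi>. \<exists>I\<in>label_seqs \<MM> 0 n. w \<xi> I \<noteq> 0}"
  have "(\<integral>\<^sup>+x. unnorm_posterior \<MM> ?k g \<pi> (states_of_labels 0 ?k I x)
        \<partial>(\<Pi>\<^sub>M il\<in>Sigma {0..?k} I. refM \<MM>))
      = c * (\<Sum>\<^sub>\<infinity>d\<in>\<Xi> \<times> ?\<Theta>. posterior_weight \<MM> ?k z w p d I)" (is "?int I = _")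
    if I: "I \<in> label_seqs \<MM> 0 ?k" for I
  proof -
    let ?M = "\<Pi>\<^sub>M il\<in>Sigma {0..?k} I. refM \<MM>"
    have "?int I = (\<integral>\<^sup>+x. (\<Sum>\<^sub>\<infinity>d\<in>\<Xi> \<times> ?\<Theta>.
        c * posterior_term \<MM> ?k z w p d (states_of_labels 0 ?k I x)) \<partial>?M)"
      by (intro nn_integral_cong)
        (simp add: infsum_cmult_right_ennreal unnorm_posterior_eq_sum[OF _ _ g prior]
          states_of_labels_in_mstate_seqs[OF I] distinct_ind_seq_states_of_labels)
    also have "\<dots> = (\<Sum>\<^sub>\<infinity>d\<in>\<Xi> \<times> ?\<Theta>.
        \<integral>\<^sup>+x. c * posterior_term \<MM> ?k z w p d (states_of_labels 0 ?k I x) \<partial>?M)"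
    proof (rule nn_integral_infsum)
      show "countable (?S \<times> ?\<Theta>)"
        using countable_weights finite_assoc_maps[OF model] by (intro countable_SIGMA) (auto intro: countable_finite)
      show "?S \<times> ?\<Theta> \<subseteq> \<Xi> \<times> ?\<Theta>" by auto
      show "(\<lambda>x. c * posterior_term \<MM> ?k z w p d (states_of_labels 0 ?k I x)) \<in> borel_measurable ?M"
        if "d \<in> ?S \<times> ?\<Theta>" for d
        using that measurable_posterior_term[OF I] by (cases d) (auto intro!: borel_measurable_times_ennreal)
      show "c * posterior_term \<MM> ?k z w p d (states_of_labels 0 ?k I x) = 0"
        if "d \<in> \<Xi> \<times> ?\<Theta> - ?S \<times> ?\<Theta>" "x \<in> space ?M" for d x
      proof (cases d)
        case (Pair \<xi> \<theta>)
        with that(1) have "\<xi> \<in> \<Xi> - ?S" by blast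
        from posterior_term_weight_0(1)[OF this states_of_labels_in_mstate_seqs[OF I that(2)]]
        show ?thesis using Pair by simp
      qed
    qed
    also have "\<dots> = (\<Sum>\<^sub>\<infinity>d\<in>\<Xi> \<times> ?\<Theta>. c * posterior_weight \<MM> ?k z w p d I)"
      using posterior_term_integral[OF I] by (intro infsum_cong) (auto simp: nn_integral_cmult)
    finally show ?thesis by (simp only: infsum_cmult_right_ennreal)
  qed
  then have "norm_const \<MM> ?k g \<pi>
      = c * (\<Sum>I\<in>label_seqs \<MM> 0 ?k. \<Sum>\<^sub>\<infinity>d\<in>\<Xi> \<times> ?\<Theta>. posterior_weight \<MM> ?k z w p d I)"
    by (simp add: norm_const_def multiscan_integral_def sum_distrib_left)
  then show ?thesis by (simp add: sum_infsum_ennreal finite_label_seqs[OF model])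
qed

end

theorem proposition7:
  fixes \<MM> :: "('x, 'a, 'z) mo_system" and k :: nat
    and Z :: "'z set" and z :: "nat \<Rightarrow> 'z"
    and g :: "'z set \<Rightarrow> ('x, 'a) mstate \<Rightarrow> ennreal"
    and \<pi> :: "(nat \<Rightarrow> ('x, 'a) mstate) \<Rightarrow> ennreal"
    and \<Xi> :: "'c set"
    and w :: "'c \<Rightarrow> (nat \<Rightarrow> 'a label set) \<Rightarrow> ennreal"
    and p :: "'c \<Rightarrow> ('x, 'a) traj_fun"
    and r :: "'c \<times> ('a label \<Rightarrow> nat option) \<Rightarrow> ('x, 'a) traj_fun"
  assumes k: "1 \<le> k"
    and model: "mo_system_model \<MM>"
    and Z: "finite Z" "bij_betw z {1..card Z} Z"
    and likelihood: "\<exists>c. 0 < c \<and> c < \<infinity> \<and>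
          (\<forall>Y\<in>mstates \<MM> k. distinct_ind Y = 1 \<longrightarrow> g Z Y = c * likelihood_sum \<MM> k Z z Y)"
    and prior_params: "multiscan_glmb_params \<MM> 0 (k - 1) \<Xi> w p"
    and prior: "\<forall>X\<in>mstate_seqs \<MM> 0 (k - 1). \<pi> X = multiscan_glmb 0 (k - 1) \<Xi> w p X"
    and well_defined: "0 < norm_const \<MM> k (g Z) \<pi>" "norm_const \<MM> k (g Z) \<pi> < \<infinity>"
    and arbitrary_densities: "\<forall>c\<in>\<Xi> \<times> assoc_maps \<MM> k Z. traj_densities \<MM> 0 k (r c)"
  shows "\<exists>C. 0 < C \<and> C < \<infinity> \<and>
    (let \<Theta> = assoc_maps \<MM> k Z;
         p' = update_density \<MM> k z r p;
         w' = (\<lambda>(\<xi>, \<theta>) I.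
           update_weight \<MM> k z w p (\<xi>, \<theta>) (restrict I {0..k - 1}) * of_bool (I k = dom \<theta>) / C)
     in multiscan_glmb_params \<MM> 0 k (\<Xi> \<times> \<Theta>) w' p' \<and>
        multiscan_AE \<MM> 0 k
          (\<lambda>X. posterior \<MM> k (g Z) \<pi> X = multiscan_glmb 0 k (\<Xi> \<times> \<Theta>) w' p' X) \<and>
        (\<forall>X\<in>mstate_seqs \<MM> 0 k. nondegenerate_at \<MM> k Z z \<Xi> p X \<longrightarrow>
           posterior \<MM> k (g Z) \<pi> X = multiscan_glmb 0 k (\<Xi> \<times> \<Theta>) w' p' X))"
proof -
  obtain n where kn: "k = Suc n" using k by (cases k) auto
  obtain c where c: "0 < c" "c < \<infinity>"
    and g: "\<forall>Y\<in>mstates \<MM> (Suc n). distinct_ind Y = 1 \<longrightarrow> g Z Y = c * likelihood_sum \<MM> (Suc n) Z z Y"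
    using likelihood kn by auto
  have params: "multiscan_glmb_params \<MM> 0 n \<Xi> w p" using prior_params kn by simp
  have prior: "\<forall>X\<in>mstate_seqs \<MM> 0 n. \<pi> X = multiscan_glmb 0 n \<Xi> w p X" using prior kn by simp
  define \<Theta> where "\<Theta> = assoc_maps \<MM> (Suc n) Z"
  define p' where "p' = update_density \<MM> (Suc n) z r p"
  define W where "W = posterior_weight \<MM> (Suc n) z w p"
  \<comment> \<open>The total updated weight. It differs from the normalising constant by the
    likelihood factor \<open>c\<close>, which also multiplies the unnormalised posterior and so
    cancels.\<close>
  define C where "C = (\<Sum>\<^sub>\<infinity>d\<in>\<Xi> \<times> \<Theta>. \<Sum>I\<in>label_seqs \<MM> 0 (Suc n). W d I)"
  define w' where "w' = (\<lambda>(\<xi>, \<theta>) I.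
    update_weight \<MM> (Suc n) z w p (\<xi>, \<theta>) (restrict I {0..n}) * of_bool (I (Suc n) = dom \<theta>) / C)"
  let ?N = "norm_const \<MM> (Suc n) (g Z) \<pi>"
  let ?term = "posterior_term \<MM> (Suc n) z w p"
  let ?post = "posterior \<MM> (Suc n) (g Z) \<pi>"
  let ?glmb = "multiscan_glmb 0 (Suc n) (\<Xi> \<times> \<Theta>) w' p'"
  have N: "?N = c * C"
    unfolding C_def W_def \<Theta>_def by (rule norm_const_eq_sum[OF model params g prior])
  have C: "0 < C" "C < \<infinity>"
    using well_defined c unfolding kn N
    by (auto simp: zero_less_iff_neq_zero less_top[symmetric] ennreal_mult_eq_top_iff)
  have w': "w' d I = inverse C * W d I" for d I
    by (cases d) (simp add: w'_def W_def posterior_weight_def divide_ennreal_def mult.commute)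
  have "(\<Sum>\<^sub>\<infinity>d\<in>\<Xi> \<times> \<Theta>. \<Sum>I\<in>label_seqs \<MM> 0 (Suc n). w' d I) = inverse C * C"
    by (simp only: w' sum_distrib_left[symmetric] infsum_cmult_right_ennreal C_def)
  also have "\<dots> = 1"
    using C by (simp add: mult.commute[of "inverse C"] divide_ennreal_def[symmetric] ennreal_divide_self less_top)
  finally have sum1: "(\<Sum>\<^sub>\<infinity>d\<in>\<Xi> \<times> \<Theta>. \<Sum>I\<in>label_seqs \<MM> 0 (Suc n). w' d I) = 1" .
  have "w' d I = 0"
    if "d \<in> \<Xi> \<times> \<Theta>" "I \<in> label_seqs \<MM> 0 (Suc n)" "\<not> trajectory_labels 0 (Suc n) I" for d I
    using posterior_weight_trajectory[OF model params that(2) _ that(3)] that(1)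
    by (cases d) (simp add: w' W_def)
  moreover have "traj_densities \<MM> 0 (Suc n) (p' d)" if "d \<in> \<Xi> \<times> \<Theta>" for d
    using that params arbitrary_densities unfolding p'_def kn \<Theta>_def
    by (cases d) (auto simp: multiscan_glmb_params_def intro!: traj_densities_update_density[OF model])
  ultimately have params': "multiscan_glmb_params \<MM> 0 (Suc n) (\<Xi> \<times> \<Theta>) w' p'"
    using sum1 by (simp add: multiscan_glmb_params_def)
  have post0: "?post X = ?glmb X"
    if X: "X \<in> mstate_seqs \<MM> 0 (Suc n)" and 0: "distinct_ind_seq 0 (Suc n) X = 0" for X
  proof -
    \<comment> \<open>A label repeated at time \<open>Suc n\<close> annihilates the transition
      density, one repeated earlier annihilates the prior. The value of \<open>g\<close> is not
      controlled here, but it is multiplied by 0.\<close>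
    have "unnorm_posterior \<MM> (Suc n) (g Z) \<pi> X = 0"
      using 0 prior mstate_seqs_restrict[OF X, of n]
      by (auto simp: distinct_ind_seq_Suc unnorm_posterior_def multiscan_glmb_def transition_density_def)
    then show ?thesis using 0 by (simp add: posterior_def multiscan_glmb_def)
  qed
  have post1: "?post X = ?glmb X"
    if X: "X \<in> mstate_seqs \<MM> 0 (Suc n)" and 1: "distinct_ind_seq 0 (Suc n) X = 1"
      and eq: "\<And>d. d \<in> \<Xi> \<times> \<Theta> \<Longrightarrow>
        ?term d X = W d (labels_seq 0 (Suc n) X) * multiscan_exp 0 (Suc n) (p' d) X" for X
  proof -
    have "?post X = (c * (\<Sum>\<^sub>\<infinity>d\<in>\<Xi> \<times> \<Theta>. ?term d X)) / (c * C)"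
      unfolding posterior_def N \<Theta>_def
      by (simp only: unnorm_posterior_eq_sum[OF model params X 1 g prior])
    also have "\<dots> = inverse C * (\<Sum>\<^sub>\<infinity>d\<in>\<Xi> \<times> \<Theta>. ?term d X)"
      unfolding ennreal_mult_divide_cancel_left[OF c C] by (simp only: divide_ennreal_def mult.commute)
    also have "\<dots> = (\<Sum>\<^sub>\<infinity>d\<in>\<Xi> \<times> \<Theta>. inverse C * ?term d X)"
      by (simp only: infsum_cmult_right_ennreal)
    also have "\<dots> = ?glmb X"
      unfolding multiscan_glmb_def 1 mult_1
      by (intro infsum_cong) (simp add: eq w' mult_ac)
    finally show ?thesis .
  qed
  have AE: "AE x in (\<Pi>\<^sub>M il\<in>Sigma {0..Suc n} I. refM \<MM>).
      ?post (states_of_labels 0 (Suc n) I x) = ?glmb (states_of_labels 0 (Suc n) I x)"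
    if I: "I \<in> label_seqs \<MM> 0 (Suc n)" for I
  proof -
    let ?M = "\<Pi>\<^sub>M il\<in>Sigma {0..Suc n} I. refM \<MM>" and ?X = "states_of_labels 0 (Suc n) I"
    let ?S = "{\<xi>\<in>\<Xi>. \<exists>I\<in>label_seqs \<MM> 0 n. w \<xi> I \<noteq> 0}"
    have fin: "W d I < \<infinity>" if "d \<in> \<Xi> \<times> \<Theta>" for d
    proof -
      have "W d I \<le> (\<Sum>I\<in>label_seqs \<MM> 0 (Suc n). W d I)"
        using finite_label_seqs[OF model] I by (intro member_le_sum) auto
      also have "\<dots> = (\<Sum>\<^sub>\<infinity>d\<in>{d}. \<Sum>I\<in>label_seqs \<MM> 0 (Suc n). W d I)" by simp
      also have "\<dots> \<le> C"
        unfolding C_def using that by (intro infsum_mono_neutral) auto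
      finally show ?thesis using C(2) by (rule le_less_trans)
    qed
    have "countable (?S \<times> \<Theta>)"
      using countable_weights[OF model params] finite_assoc_maps[OF model, of "Suc n" Z]
      unfolding \<Theta>_def by (intro countable_SIGMA) (auto intro: countable_finite)
    moreover have "AE x in ?M. ?term d (?X x) = W d I * multiscan_exp 0 (Suc n) (p' d) (?X x)"
      if "d \<in> ?S \<times> \<Theta>" for d
    proof (cases d)
      case (Pair \<xi> \<theta>)
      with that have "\<xi> \<in> \<Xi>" "(\<xi>, \<theta>) \<in> \<Xi> \<times> \<Theta>" by auto
      from AE_posterior_term_eq_weight[OF model params I this(1)] fin[OF this(2)]
      show ?thesis unfolding Pair W_def p'_def by blast
    qed
    \<comment> \<open>Null sets are united only over these countably many components; for the others
      both sides are 0 at every point, so they add no exceptional set.\<close>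
    ultimately have "AE x in ?M. \<forall>d\<in>?S \<times> \<Theta>.
        ?term d (?X x) = W d I * multiscan_exp 0 (Suc n) (p' d) (?X x)"
      by (intro AE_ball_countable')
    then show ?thesis
      using AE_space
    proof eventually_elim
      case (elim x)
      have X: "?X x \<in> mstate_seqs \<MM> 0 (Suc n)"
        by (rule states_of_labels_in_mstate_seqs[OF I elim(2)])
      show ?case
      proof (rule post1[OF X distinct_ind_seq_states_of_labels])
        fix d assume d: "d \<in> \<Xi> \<times> \<Theta>"
        show "?term d (?X x) = W d (labels_seq 0 (Suc n) (?X x)) * multiscan_exp 0 (Suc n) (p' d) (?X x)"
          unfolding labels_seq_states_of_labels[OF I]
        proof (cases "d \<in> ?S \<times> \<Theta>")
          case True
          then show "?term d (?X x) = W d I * multiscan_exp 0 (Suc n) (p' d) (?X x)"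
            using elim(1) by blast
        next
          case False
          with d obtain \<xi> \<theta> where d': "d = (\<xi>, \<theta>)" "\<xi> \<in> \<Xi> - ?S" by auto
          show "?term d (?X x) = W d I * multiscan_exp 0 (Suc n) (p' d) (?X x)"
            unfolding d'(1) W_def posterior_term_weight_0(1)[OF model params d'(2) X]
              posterior_term_weight_0(2)[OF model params d'(2) I] by simp
        qed
      qed
    qed
  qed
  have nondeg: "?post X = ?glmb X"
    if X: "X \<in> mstate_seqs \<MM> 0 (Suc n)" and nd: "nondegenerate_at \<MM> (Suc n) Z z \<Xi> p X" for X
  proof (cases rule: distinct_ind_seq_cases[of 0 "Suc n" X])
    case 1
    then show ?thesis by (rule post0[OF X])
  next
    case 2
    show ?thesis
    proof (rule post1[OF X 2(1)])
      fix d assume d: "d \<in> \<Xi> \<times> \<Theta>"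
      then obtain \<xi> \<theta> where d': "d = (\<xi>, \<theta>)" "\<xi> \<in> \<Xi>" "\<theta> \<in> \<Theta>" by auto
      show "?term d X = W d (labels_seq 0 (Suc n) X) * multiscan_exp 0 (Suc n) (p' d) X"
        unfolding d'(1) W_def p'_def
      proof (rule posterior_term_eq_weight[OF model params X d'(2)])
        fix l assume dom: "dom \<theta> = labels (X (Suc n))"
          and l: "l \<in> (births \<MM> (Suc n) \<inter> dom \<theta>) \<union> labels (X n)"
        \<comment> \<open>\<open>nondegenerate_at\<close> speaks only about maps whose domain is the
          label set at the new time; the premise \<open>dom\<close> places \<theta> among
          them.\<close>
        have "\<theta> \<in> assoc_maps_on \<MM> (Suc n) Z (labels (X (Suc n)))"
          using d'(3) dom by (simp add: assoc_maps_on_def \<Theta>_def)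
        then show "0 < step_weight \<MM> (Suc n) z (p \<xi>) \<theta> l \<and> step_weight \<MM> (Suc n) z (p \<xi>) \<theta> l < \<infinity>"
          using nd d'(2) l dom unfolding nondegenerate_at_def by auto
      qed
    qed
  qed
  have "multiscan_AE \<MM> 0 (Suc n) (\<lambda>X. ?post X = ?glmb X)"
    unfolding multiscan_AE_def using post0 AE by blast
  then show ?thesis
    using C params' nondeg
    unfolding kn Let_def diff_Suc_1 \<Theta>_def[symmetric] p'_def[symmetric]
    by (intro exI[of _ C]) (simp only: w'_def[symmetric], blast)
qed

end
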